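(* There exist a Cantor set $C\subset\overline{\mathbb C}$ with Hausdorff dimension $\dim_H(C)=0$ and a proper holomorphic embedding $\gamma\colon\overline{\mathbb C}\setminus C\hookrightarrow\mathbb C^2$.
   Context: $\overline{\mathbb C}=\mathbb C\cup\{\infty\}$ is the Riemann sphere, equipped with the spherical (chordal-angle) metric $d(x,y)=\arccos(\varphi(x)\cdot\varphi(y))$, where $\varphi$ is the stereographic projection onto the unit sphere $\mathbb S^2\subset\mathbb R^3$; Hausdorff measures and dimension are taken with respect to this metric. A Cantor set is a subset homeomorphic to the classical middle-thirds Cantor set (equivalently: nonempty, compact, perfect, totally disconnected, metrizable). *)

theory Defs
  imports "HOL-Analysis.Analysis"
begin

text \<open>The Riemann sphere is modelled as the unit sphere S^2 in R x C (= R^3),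
  a point (t, w) with t^2 + |w|^2 = 1.  The stereographic identification
  sends z in C to stereo_inv z and infinity to the north pole (1, 0).\<close>

type_synonym rs_point = "real \<times> complex"

abbreviation riemann_sphere :: "rs_point set" where
  "riemann_sphere \<equiv> sphere 0 1"

definition stereo_inv :: "complex \<Rightarrow> rs_point" where
  "stereo_inv z = ((cmod z ^ 2 - 1) / (cmod z ^ 2 + 1),
                   complex_of_real (2 / (cmod z ^ 2 + 1)) * z)"

text \<open>Chart at infinity: the point with coordinate w corresponds to z = 1/w
  (w = 0 is infinity, i.e. the north pole).\<close>
definition stereo_inv_inf :: "complex \<Rightarrow> rs_point" where
  "stereo_inv_inf w = ((1 - cmod w ^ 2) / (cmod w ^ 2 + 1),
                       complex_of_real (2 / (cmod w ^ 2 + 1)) * cnj w)"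

definition sph_dist :: "rs_point \<Rightarrow> rs_point \<Rightarrow> real" where
  "sph_dist x y = arccos (x \<bullet> y)"

definition sph_diam :: "rs_point set \<Rightarrow> real" where
  "sph_diam U = (if U = {} then 0 else Sup {sph_dist x y | x y. x \<in> U \<and> y \<in> U})"

definition haus_term :: "real \<Rightarrow> rs_point set \<Rightarrow> real" where
  "haus_term s U = (if U = {} then 0 else if s = 0 then 1 else sph_diam U powr s)"

definition sph_hausdorff_pre :: "real \<Rightarrow> real \<Rightarrow> rs_point set \<Rightarrow> ennreal" where
  "sph_hausdorff_pre s \<delta> A =
     (INF U \<in> {U :: nat \<Rightarrow> rs_point set.
                 (\<forall>i. U i \<subseteq> riemann_sphere \<and> sph_diam (U i) \<le> \<delta>) \<and> A \<subseteq> (\<Union>i. U i)}.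
        (\<Sum>i. ennreal (haus_term s (U i))))"

definition sph_hausdorff :: "real \<Rightarrow> rs_point set \<Rightarrow> ennreal" where
  "sph_hausdorff s A = (SUP \<delta> \<in> {0<..}. sph_hausdorff_pre s \<delta> A)"

definition sph_hausdorff_dim :: "rs_point set \<Rightarrow> real" where
  "sph_hausdorff_dim A = Inf {s. 0 \<le> s \<and> sph_hausdorff s A = 0}"

fun cantor_approx :: "nat \<Rightarrow> real set" where
  "cantor_approx 0 = {0..1}"
| "cantor_approx (Suc n) = (\<lambda>x. x / 3) ` cantor_approx n \<union> (\<lambda>x. x / 3 + 2 / 3) ` cantor_approx n"

definition middle_third_cantor :: "real set" where
  "middle_third_cantor = (\<Inter>n. cantor_approx n)"

definition is_cantor_set :: "rs_point set \<Rightarrow> bool" where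
  "is_cantor_set C \<longleftrightarrow> C \<subseteq> riemann_sphere \<and> middle_third_cantor homeomorphic C"

definition sph_holomorphic_on :: "(rs_point \<Rightarrow> complex) \<Rightarrow> rs_point set \<Rightarrow> bool" where
  "sph_holomorphic_on f U \<longleftrightarrow>
     (f \<circ> stereo_inv) holomorphic_on (stereo_inv -` U) \<and>
     (f \<circ> stereo_inv_inf) holomorphic_on (stereo_inv_inf -` U)"

definition sph_immersion :: "(rs_point \<Rightarrow> complex \<times> complex) \<Rightarrow> rs_point set \<Rightarrow> bool" where
  "sph_immersion g U \<longleftrightarrow>
     (\<forall>z \<in> stereo_inv -` U. deriv (fst \<circ> g \<circ> stereo_inv) z \<noteq> 0 \<or> deriv (snd \<circ> g \<circ> stereo_inv) z \<noteq> 0) \<and>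
     (\<forall>w \<in> stereo_inv_inf -` U. deriv (fst \<circ> g \<circ> stereo_inv_inf) w \<noteq> 0 \<or> deriv (snd \<circ> g \<circ> stereo_inv_inf) w \<noteq> 0)"

definition holomorphic_embedding :: "(rs_point \<Rightarrow> complex \<times> complex) \<Rightarrow> rs_point set \<Rightarrow> bool" where
  "holomorphic_embedding g U \<longleftrightarrow>
     sph_holomorphic_on (fst \<circ> g) U \<and> sph_holomorphic_on (snd \<circ> g) U \<and>
     sph_immersion g U \<and> inj_on g U \<and> (\<exists>h. homeomorphism U (g ` U) g h)"

definition proper_map_on :: "('a::topological_space \<Rightarrow> 'b::topological_space) \<Rightarrow> 'a set \<Rightarrow> bool" where
  "proper_map_on g U \<longleftrightarrow> (\<forall>K. compact K \<longrightarrow> compact {x \<in> U. g x \<in> K})"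

end

theory Submission
  imports Defs "HOL-Complex_Analysis.Complex_Analysis"
begin

text \<open>
  Start from \<open>G\<^sub>0(z) = (z, 0)\<close>, with a single puncture at infinity, and compose with
  rational shears \<open>p \<mapsto> p + \<epsilon> / (l\<^sub>n(p) - a) \<sqdot> v\<^sub>n\<close>, where the linear
  forms \<open>l\<^sub>n\<close> are pairwise independent and \<open>l\<^sub>n(v\<^sub>n) = 0\<close>.  Every puncture is a simple
  pole of \<open>l\<^sub>n \<circ> G\<^sub>n\<close>, so for large \<open>a\<close> the line \<open>l\<^sub>n = a\<close> meets the
  curve \<open>G\<^sub>n\<close> exactly once near each puncture and nowhere else: each puncture is split into two.
  The shear is close to the identity except near that line, which is far away from the origin;
  hence the \<open>G\<^sub>n\<close> converge, with uniform lower Lipschitz bounds, to an injective immersion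
  off the limit set of the punctures, and properness survives in the limit.  The punctures
  of stage \<open>n + 1\<close> can be confined to arbitrarily small discs about those of stage \<open>n\<close>, so
  the limit set is a Cantor set of dimension \<open>0\<close>.
\<close>

section \<open>The middle-thirds Cantor set and binary schemes\<close>

text \<open>A shear leaves its own form \<open>lin n\<close> unchanged, so it is injective whatever
  the curve looks like. For the same reason \<open>lin n\<close> gets no pole at the new punctures.
  Hence each step uses another form, and the induction hypothesis asks for simple poles of all forms
  \<open>lin m\<close> with \<open>m \<ge> n\<close>. At an old puncture the added term
  \<open>e / (lin n - a)\<close> tends to 0, so the poles survive; at a new one it has a simple
  pole, which enters \<open>lin m\<close> with the factor \<open>slope n - slope m\<close>, nonzero
  for \<open>m > n\<close>. The order of choices matters: the radius of the discs comes first, then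
  \<open>a\<close>, large compared with the curve outside the discs, then the new punctures, and
  only then the next radius. The radii can therefore shrink at will, and \<open>2 ^ n\<close> discs
  of size at most \<open>(1/2) ^ (n * n)\<close> force dimension 0. Properness rests on points
  inside the discs of stage \<open>n\<close>: there the norm is at least \<open>n + 1\<close>, and
  every later step either moves a point by a summable amount or throws it beyond a growing radius,
  so the limit has norm at least \<open>n\<close>.\<close>

definition ternary :: "(nat \<Rightarrow> bool) \<Rightarrow> real" where
  "ternary s = (\<Sum>n. (if s n then 2 else 0) / 3 ^ Suc n)"

lemma ternary_summand_le: "norm ((if b then 2 else 0) / 3 ^ Suc n :: real) \<le> (2/3) * (1/3) ^ n"
  by (simp add: power_one_over field_simps)

lemma geometric_majorant_summable: "summable (\<lambda>n. (2/3) * (1/3 :: real) ^ n)"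
  by (intro summable_mult summable_geometric) simp

lemma ternary_summable: "summable (\<lambda>n. (if s n then 2 else 0) / 3 ^ Suc n :: real)"
  by (rule summable_comparison_test'[OF geometric_majorant_summable])
    (rule ternary_summand_le)

lemma ternary_unfold:
  "ternary s = (if s 0 then 2/3 else 0) + ternary (\<lambda>n. s (Suc n)) / 3"
proof -
  have "ternary s = (\<Sum>n. (if s (Suc n) then 2 else 0) / 3 ^ Suc (Suc n)) + (if s 0 then 2/3 else 0)"
    using suminf_split_head[OF ternary_summable, of s] by (simp add: ternary_def)
  also have "(\<Sum>n. (if s (Suc n) then 2 else 0) / 3 ^ Suc (Suc n) :: real)
      = (\<Sum>n. (if s (Suc n) then 2 else 0) / 3 ^ Suc n / 3)"
    by (simp add: field_simps)
  also have "\<dots> = ternary (\<lambda>n. s (Suc n)) / 3"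
    unfolding ternary_def by (rule suminf_divide[OF ternary_summable])
  finally show ?thesis by simp
qed

lemma ternary_bounds: "0 \<le> ternary s" "ternary s \<le> 1"
proof -
  show "0 \<le> ternary s"
    unfolding ternary_def by (rule suminf_nonneg[OF ternary_summable]) simp
  have "ternary s \<le> (\<Sum>n. (2/3) * (1/3 :: real) ^ n)"
    unfolding ternary_def
    using ternary_summand_le
    by (intro suminf_le ternary_summable geometric_majorant_summable) (metis real_norm_def abs_le_D1)
  also have "\<dots> = 1"
    by (subst suminf_mult) (auto simp: suminf_geometric summable_geometric)
  finally show "ternary s \<le> 1" .
qed

text \<open>Values with first digit 0 lie in \<open>[0, 1/3]\<close>, those with first digit 2 in
  \<open>[2/3, 1]\<close>; the gap determines the digit, and the tails are compared by
  induction.\<close>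

lemma ternary_inj:
  assumes "ternary s = ternary t"
  shows "s = t"
proof
  fix n
  show "s n = t n" using assms
  proof (induction n arbitrary: s t)
    case 0
    show ?case
      using ternary_unfold[of s] ternary_unfold[of t] 0
        ternary_bounds[of "\<lambda>n. s (Suc n)"] ternary_bounds[of "\<lambda>n. t (Suc n)"]
      by (auto split: if_splits)
  next
    case (Suc n)
    have "s 0 = t 0"
      using ternary_unfold[of s] ternary_unfold[of t] Suc.prems
        ternary_bounds[of "\<lambda>n. s (Suc n)"] ternary_bounds[of "\<lambda>n. t (Suc n)"]
      by (auto split: if_splits)
    then have "ternary (\<lambda>n. s (Suc n)) = ternary (\<lambda>n. t (Suc n))"
      using ternary_unfold[of s] ternary_unfold[of t] Suc.prems by simp
    then show ?case using Suc.IH[of "\<lambda>n. s (Suc n)" "\<lambda>n. t (Suc n)"] by simp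
  qed
qed

lemma ternary_in_cantor_approx: "ternary s \<in> cantor_approx n"
proof (induction n arbitrary: s)
  case 0
  then show ?case using ternary_bounds by simp
next
  case (Suc n)
  have "ternary (\<lambda>n. s (Suc n)) \<in> cantor_approx n" by (rule Suc.IH)
  then show ?case
    by (subst ternary_unfold) (auto simp: image_iff intro!: bexI[of _ "ternary (\<lambda>n. s (Suc n))"])
qed

lemma cantor_approx_subset: "cantor_approx n \<subseteq> {0..1}"
  by (induction n) (auto simp: field_simps)

text \<open>The digits of a point of the Cantor set are read off the orbit of the expanding map.\<close>

definition cantor_shift :: "real \<Rightarrow> real" where
  "cantor_shift x = (if x \<ge> 1/2 then 3 * x - 2 else 3 * x)"

lemma cantor_shift_mem:
  assumes "x \<in> middle_third_cantor"
  shows "cantor_shift x \<in> middle_third_cantor"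
proof -
  have "cantor_shift x \<in> cantor_approx n" for n
  proof -
    have "x \<in> cantor_approx (Suc n)"
      using assms unfolding middle_third_cantor_def by blast
    then obtain y where "y \<in> cantor_approx n" "x = y / 3 \<or> x = y / 3 + 2/3"
      by auto
    moreover from this(1) have "y \<in> {0..1}" using cantor_approx_subset by blast
    ultimately have "cantor_shift x = y" by (auto simp: cantor_shift_def)
    with \<open>y \<in> cantor_approx n\<close> show ?thesis by simp
  qed
  then show ?thesis by (auto simp: middle_third_cantor_def)
qed

lemma middle_third_eq_range_ternary: "middle_third_cantor = range ternary"
proof
  show "range ternary \<subseteq> middle_third_cantor"
    using ternary_in_cantor_approx by (auto simp: middle_third_cantor_def)
  show "middle_third_cantor \<subseteq> range ternary"
  proof
    fix x assume x: "x \<in> middle_third_cantor"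
    define s where "s n = ((cantor_shift ^^ n) x \<ge> 1/2)" for n
    have mem: "(cantor_shift ^^ n) x \<in> middle_third_cantor" for n
      by (induction n) (auto simp: x cantor_shift_mem)
    have bd: "y \<in> {0..1}" if "y \<in> middle_third_cantor" for y
    proof -
      have "y \<in> cantor_approx 0" using that unfolding middle_third_cantor_def by (rule INT_D) simp
      then show ?thesis by simp
    qed
    \<comment> \<open>A finite expansion with explicit remainder; the remainder tends to 0 because
      the orbit stays in \<open>[0, 1]\<close>.\<close>
    have partial: "x = (\<Sum>i<n. (if s i then 2 else 0) / 3 ^ Suc i) + (cantor_shift ^^ n) x / 3 ^ n" for n
    proof (induction n)
      case (Suc n)
      have "(cantor_shift ^^ n) x / 3 ^ n
        = (if s n then 2 else 0) / 3 ^ Suc n + (cantor_shift ^^ Suc n) x / 3 ^ Suc n"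
        by (simp add: s_def cantor_shift_def field_simps)
      with Suc show ?case by simp
    qed simp
    have "(\<lambda>n. (cantor_shift ^^ n) x / 3 ^ n) \<longlonglongrightarrow> 0"
    proof (rule tendsto_sandwich[of "\<lambda>_. 0" _ _ "\<lambda>n. (1/3) ^ n"])
      show "\<forall>\<^sub>F n in sequentially. 0 \<le> (cantor_shift ^^ n) x / 3 ^ n"
        using bd[OF mem] by (auto intro!: always_eventually divide_nonneg_pos)
      show "\<forall>\<^sub>F n in sequentially. (cantor_shift ^^ n) x / 3 ^ n \<le> (1/3) ^ n"
        using bd[OF mem] by (auto intro!: always_eventually simp: power_one_over divide_right_mono)
      show "(\<lambda>n. (1/3 :: real) ^ n) \<longlonglongrightarrow> 0" by (rule LIMSEQ_realpow_zero) auto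
    qed simp
    then have "(\<lambda>n. x - (cantor_shift ^^ n) x / 3 ^ n) \<longlonglongrightarrow> x - 0"
      by (intro tendsto_diff tendsto_const)
    moreover have "(\<lambda>n. x - (cantor_shift ^^ n) x / 3 ^ n) = (\<lambda>n. \<Sum>i<n. (if s i then 2 else 0) / 3 ^ Suc i)"
      using partial by (auto simp: fun_eq_iff algebra_simps)
    ultimately have "(\<lambda>n. (if s n then 2 else 0) / 3 ^ Suc n) sums x"
      by (simp add: sums_def)
    then have "x = ternary s" by (simp add: ternary_def sums_unique)
    then show "x \<in> range ternary" by blast
  qed
qed

text \<open>The \<open>b n\<close> serve as binary digits. Reading them as ternary digits 0 and 2
  gives a uniform limit of continuous functions that is a bijection from a compact set, so its
  inverse is automatically continuous.\<close>

lemma middle_third_homeomorphicI: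
  fixes C :: "'a::metric_space set" and b :: "nat \<Rightarrow> 'a \<Rightarrow> bool"
  assumes "compact C"
    and cont: "\<And>n. continuous_on C (\<lambda>x. if b n x then 1 else 0 :: real)"
    and inj: "\<And>x y. x \<in> C \<Longrightarrow> y \<in> C \<Longrightarrow> (\<And>n. b n x = b n y) \<Longrightarrow> x = y"
    and surj: "\<And>s. \<exists>x\<in>C. \<forall>n. b n x = s n"
  shows "middle_third_cantor homeomorphic C"
proof -
  define f where "f x = ternary (\<lambda>n. b n x)" for x
  have lim: "uniform_limit C (\<lambda>n x. \<Sum>i<n. (if b i x then 2 else 0) / 3 ^ Suc i) f sequentially"
    unfolding f_def ternary_def
    by (rule Weierstrass_m_test[OF _ geometric_majorant_summable]) (rule ternary_summand_le)
  have "continuous_on C f"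
  proof (rule uniform_limit_theorem[OF _ lim])
    have "continuous_on C (\<lambda>x. (if b i x then 1 else 0) * (2 / 3 ^ Suc i :: real))" for i
      by (intro continuous_on_mult cont continuous_on_const)
    moreover have "(\<lambda>x. (if b i x then 1 else 0) * (2 / 3 ^ Suc i :: real))
        = (\<lambda>x. (if b i x then 2 else 0) / 3 ^ Suc i)" for i
      by (rule ext) simp
    ultimately have "continuous_on C (\<lambda>x. (if b i x then 2 else 0) / 3 ^ Suc i :: real)" for i
      by metis
    then show "\<forall>\<^sub>F n in sequentially. continuous_on C (\<lambda>x. \<Sum>i<n. (if b i x then 2 else 0) / 3 ^ Suc i :: real)"
      by (intro always_eventually allI continuous_on_sum)
  qed simp
  moreover have "f ` C = middle_third_cantor"
  proof -
    have "ternary s \<in> f ` C" for s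
    proof -
      obtain x where "x \<in> C" "\<forall>n. b n x = s n" using surj by blast
      moreover from this(2) have "(\<lambda>n. b n x) = s" by auto
      ultimately show ?thesis by (metis f_def image_eqI)
    qed
    then show ?thesis by (auto simp: middle_third_eq_range_ternary f_def)
  qed
  moreover have "inj_on f C"
    unfolding f_def by (intro inj_onI inj) (auto dest: ternary_inj fun_cong)
  ultimately have "C homeomorphic middle_third_cantor"
    by (rule homeomorphic_compact[OF \<open>compact C\<close>])
  then show ?thesis by (rule homeomorphic_sym[THEN iffD1])
qed

section \<open>Spherical Hausdorff dimension\<close>

text \<open>Compares an angle with its chord \<open>d\<close>. The sharp factor is
  \<open>pi / 2\<close>; with 3 two crude bounds suffice: the angle is at most \<open>pi\<close> if
  \<open>d \<ge> pi / 3\<close>, and at most \<open>2 * d\<close> below that.\<close>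

lemma arccos_le_chord:
  assumes "0 \<le> d" "d \<le> 2"
  shows "arccos (1 - d\<^sup>2 / 2) \<le> 3 * d"
proof -
  have "d\<^sup>2 \<le> 2\<^sup>2" using assms by (intro power_mono) auto
  then have range: "-1 \<le> 1 - d\<^sup>2 / 2" "1 - d\<^sup>2 / 2 \<le> 1" by auto
  show ?thesis
  proof (cases "d \<ge> pi / 3")
    case True
    then show ?thesis using arccos_ubound[OF range] by linarith
  next
    case False
    \<comment> \<open>Mean value theorem, with \<open>cos \<ge> 1/2\<close> on
      \<open>[0, pi / 3]\<close>. The double angle formula then compares \<open>cos (2 * d)\<close>
      with \<open>1 - d\<^sup>2 / 2\<close>.\<close>
    have "d / 2 \<le> sin d"
    proof (cases "d = 0")
      case False
      then have "0 < d" using assms by simp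
      then obtain \<xi> where \<xi>: "0 < \<xi>" "\<xi> < d" "sin d - sin 0 = (d - 0) * cos \<xi>"
        using MVT2[of 0 d sin cos] by (auto intro: derivative_eq_intros)
      have "cos (pi / 3) \<le> cos \<xi>"
        using \<xi> \<open>\<not> d \<ge> pi / 3\<close> by (intro cos_monotone_0_pi_le) auto
      then have "d * (1 / 2) \<le> d * cos \<xi>" using \<open>0 < d\<close> by (intro mult_left_mono) (auto simp: cos_60)
      then show ?thesis using \<xi>(3) by simp
    qed simp
    then have "(d / 2)\<^sup>2 \<le> (sin d)\<^sup>2" using assms by (intro power_mono) auto
    then have "cos (2 * d) \<le> 1 - d\<^sup>2 / 2" unfolding cos_double_sin by (simp add: power_divide)
    then have "arccos (1 - d\<^sup>2 / 2) \<le> arccos (cos (2 * d))"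
      using range by (intro arccos_le_arccos) auto
    also have "\<dots> = 2 * d" using False assms pi_gt_zero by (intro arccos_cos) auto
    finally show ?thesis using assms by simp
  qed
qed

lemma sph_dist_bounds:
  assumes "x \<in> riemann_sphere" "y \<in> riemann_sphere"
  shows "0 \<le> sph_dist x y" "sph_dist x y \<le> 3 * dist x y"
proof -
  have n: "x \<bullet> x = 1" "y \<bullet> y = 1" using assms by (auto simp: dot_square_norm)
  have "(dist x y)\<^sup>2 = 2 - 2 * (x \<bullet> y)"
    using n by (simp add: dist_norm dot_square_norm[symmetric] inner_diff inner_commute)
  then have eq: "x \<bullet> y = 1 - (dist x y)\<^sup>2 / 2" by (simp add: field_simps)
  have "\<bar>x \<bullet> y\<bar> \<le> 1" using Cauchy_Schwarz_ineq2[of x y] assms by simp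
  then show "0 \<le> sph_dist x y" unfolding sph_dist_def by (intro arccos_lbound) auto
  have "dist x y \<le> 2" using norm_triangle_ineq4[of x y] assms by (simp add: dist_norm)
  then show "sph_dist x y \<le> 3 * dist x y"
    unfolding sph_dist_def eq by (intro arccos_le_chord) auto
qed

lemma sph_diam_bounds:
  assumes "U \<subseteq> riemann_sphere" "U \<subseteq> cball p r" "0 \<le> r"
  shows "0 \<le> sph_diam U" "sph_diam U \<le> 6 * r"
proof -
  have bound: "sph_dist x y \<le> 6 * r" if "x \<in> U" "y \<in> U" for x y
  proof -
    have "dist x y \<le> 2 * r"
    proof -
      have "dist p x \<le> r" "dist p y \<le> r" using that assms(2) by auto
      then show ?thesis using dist_triangle3[of x y p] by linarith
    qed
    moreover have "sph_dist x y \<le> 3 * dist x y" using sph_dist_bounds(2) that assms(1) by blast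
    ultimately show ?thesis by linarith
  qed
  show "sph_diam U \<le> 6 * r"
  proof (cases "U = {}")
    case False
    then have "Sup {sph_dist x y | x y. x \<in> U \<and> y \<in> U} \<le> 6 * r"
      using bound by (intro cSup_least) blast+
    then show ?thesis using False by (simp add: sph_diam_def)
  qed (simp add: sph_diam_def assms(3))
  show "0 \<le> sph_diam U"
  proof (cases "U = {}")
    case False
    then obtain x where x: "x \<in> U" by blast
    have bdd: "bdd_above {sph_dist x y | x y. x \<in> U \<and> y \<in> U}"
      using bound by (intro bdd_aboveI[of _ "6 * r"]) blast
    have "0 \<le> sph_dist x x" using sph_dist_bounds(1)[of x x] x assms(1) by blast
    also have "\<dots> \<le> Sup {sph_dist x y | x y. x \<in> U \<and> y \<in> U}"
      using x by (intro cSup_upper[OF _ bdd]) blast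
    finally show ?thesis using False by (simp add: sph_diam_def)
  qed (simp add: sph_diam_def)
qed

lemma sph_hausdorff_pre_finite_cover:
  assumes "finite P" "0 \<le> r" "6 * r \<le> \<delta>" "0 < s"
    and "C \<subseteq> riemann_sphere" "C \<subseteq> (\<Union>p\<in>P. cball p r)"
  shows "sph_hausdorff_pre s \<delta> C \<le> ennreal (card P * (6 * r) powr s)"
proof -
  obtain e where e: "bij_betw e {..<card P} P"
    using ex_bij_betw_nat_finite[OF assms(1)] by (auto simp: atLeast0LessThan)
  \<comment> \<open>The premeasure wants a sequence of sets; the finite cover is padded with empty
    sets, whose \<open>haus_term\<close> is 0.\<close>
  define U where "U i = (if i < card P then riemann_sphere \<inter> cball (e i) r else {})" for i
  have U: "U i \<subseteq> riemann_sphere" "U i \<subseteq> cball (e i) r" for i by (auto simp: U_def)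
  note diam = sph_diam_bounds[OF U assms(2)]
  have "\<forall>i. U i \<subseteq> riemann_sphere \<and> sph_diam (U i) \<le> \<delta>"
    using U(1) diam(2) assms(3) order_trans by blast
  moreover have "C \<subseteq> (\<Union>i. U i)"
  proof
    fix x assume x: "x \<in> C"
    then obtain p where "p \<in> P" "x \<in> cball p r" using assms(6) by blast
    moreover from this(1) obtain i where "i < card P" "e i = p"
      using bij_betw_imp_surj_on[OF e] by (metis imageE lessThan_iff)
    ultimately show "x \<in> (\<Union>i. U i)" using x assms(5) by (auto simp: U_def intro!: exI[of _ i])
  qed
  ultimately have "sph_hausdorff_pre s \<delta> C \<le> (\<Sum>i. ennreal (haus_term s (U i)))"
    unfolding sph_hausdorff_pre_def by (intro INF_lower) blast
  also have "\<dots> = (\<Sum>i<card P. ennreal (haus_term s (U i)))"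
    by (rule suminf_finite) (auto simp: U_def haus_term_def)
  also have "\<dots> \<le> (\<Sum>i<card P. ennreal ((6 * r) powr s))"
  proof (rule sum_mono)
    fix i
    have "sph_diam (U i) powr s \<le> (6 * r) powr s"
      using diam assms(4) by (intro powr_mono2) auto
    then show "ennreal (haus_term s (U i)) \<le> ennreal ((6 * r) powr s)"
      using assms(4) by (auto simp: haus_term_def intro!: ennreal_leI)
  qed
  also have "\<dots> = ennreal (card P * (6 * r) powr s)"
    by (simp add: ennreal_mult ennreal_of_nat_eq_real_of_nat)
  finally show ?thesis .
qed

text \<open>The covers contribute at most \<open>2 ^ n * 2 powr (- s * n * n)\<close> to the
  \<open>s\<close>-dimensional sum, which is at most \<open>(1/2) ^ n\<close> once
  \<open>n * s \<ge> 2\<close>. So the measure vanishes for every \<open>s > 0\<close>, however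
  small.\<close>

lemma sph_hausdorff_dim_eq_0:
  assumes "C \<subseteq> riemann_sphere"
    and cover: "\<And>n. \<exists>P r. finite P \<and> card P \<le> 2 ^ n \<and> 0 \<le> r \<and> 6 * r \<le> (1/2) ^ (n * n) \<and> C \<subseteq> (\<Union>p\<in>P. cball p r)"
  shows "sph_hausdorff_dim C = 0"
proof -
  have zero: "sph_hausdorff s C = 0" if s: "0 < s" for s
  proof -
    have "sph_hausdorff_pre s \<delta> C \<le> 0" if \<delta>: "0 < \<delta>" for \<delta>
    proof -
      have "\<forall>\<^sub>F n in sequentially. sph_hausdorff_pre s \<delta> C \<le> ennreal ((1/2) ^ n)"
      proof -
        have "(\<lambda>n. (1/2 :: real) ^ n) \<longlonglongrightarrow> 0" by (rule LIMSEQ_realpow_zero) auto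
        then have "\<forall>\<^sub>F n in sequentially. (1/2) ^ n < \<delta>" by (rule order_tendstoD) (rule \<delta>)
        moreover have "\<forall>\<^sub>F n in sequentially. 2 / s \<le> real n"
          using filterlim_real_sequentially by (simp add: filterlim_at_top)
        moreover have "\<forall>\<^sub>F n in sequentially. 1 \<le> n" by (rule eventually_ge_at_top)
        ultimately show ?thesis
        proof eventually_elim
          case (elim n)
          obtain P r where P: "finite P" "card P \<le> 2 ^ n" "0 \<le> r" "6 * r \<le> (1/2) ^ (n * n)"
            "C \<subseteq> (\<Union>p\<in>P. cball p r)" using cover[of n] by blast
          have "(1/2 :: real) ^ (n * n) \<le> (1/2) ^ n" using elim by (intro power_decreasing) auto
          then have "6 * r \<le> \<delta>" using P elim by linarith
          then have "sph_hausdorff_pre s \<delta> C \<le> ennreal (card P * (6 * r) powr s)"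
            using sph_hausdorff_pre_finite_cover[OF P(1,3) _ s assms(1) P(5)] by blast
          also have "\<dots> \<le> ennreal ((1/2) ^ n)"
          proof (rule ennreal_leI)
            have "(6 * r) powr s \<le> ((1/2) ^ (n * n)) powr s"
              using P s by (intro powr_mono2) auto
            also have "\<dots> = (1/2) powr (real n * (real n * s))"
              by (simp add: powr_powr flip: powr_realpow) (simp add: mult.assoc)
            also have "\<dots> \<le> (1/2) powr (real n * 2)"
              using elim s by (intro powr_mono' mult_left_mono) (auto simp: field_simps)
            also have "\<dots> = (1/4) ^ n"
              by (simp add: mult.commute[of "real n"] powr_realpow power_divide flip: powr_powr)
            finally have "card P * (6 * r) powr s \<le> 2 ^ n * (1/4) ^ n"
              using P(2) by (intro mult_mono) (auto simp flip: of_nat_power of_nat_le_iff)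
            also have "\<dots> = (1/2 :: real) ^ n" by (simp flip: power_mult_distrib)
            finally show "card P * (6 * r) powr s \<le> (1/2) ^ n" .
          qed
          finally show ?case .
        qed
      qed
      moreover have "(\<lambda>n. ennreal ((1/2) ^ n)) \<longlonglongrightarrow> ennreal 0"
        by (intro tendsto_ennrealI LIMSEQ_realpow_zero) auto
      ultimately show ?thesis
        using tendsto_lowerbound[of "\<lambda>n. ennreal ((1/2) ^ n)" "ennreal 0" sequentially] by auto
    qed
    then show ?thesis unfolding sph_hausdorff_def
      by (intro antisym SUP_least) auto
  qed
  show ?thesis
    unfolding sph_hausdorff_dim_def
  \<comment> \<open>Measure 0 is known for positive exponents only, so the infimum is found as a
    limit: a lower bound of all positive reals is at most 0.\<close>
  proof (rule cInf_eq_non_empty)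
    show "{s. 0 \<le> s \<and> sph_hausdorff s C = 0} \<noteq> {}" using zero[of 1] by (auto intro!: exI[of _ 1])
    fix y assume "\<And>x. x \<in> {s. 0 \<le> s \<and> sph_hausdorff s C = 0} \<Longrightarrow> y \<le> x"
    then have "y \<le> x" if "0 < x" for x using zero that by auto
    then show "y \<le> 0" by (meson dense leD leI)
  qed auto
qed

section \<open>The two charts of the sphere\<close>

definition stereo :: "rs_point \<Rightarrow> complex" where
  "stereo x = snd x / complex_of_real (1 - fst x)"

text \<open>The half turn of the sphere about the real axis, that is
  \<open>z \<mapsto> 1 / z\<close> in the coordinate. It exchanges the two charts, so facts about
  \<open>stereo_inv\<close> carry over by isometry.\<close>

definition antipodal_conj :: "rs_point \<Rightarrow> rs_point" where
  "antipodal_conj x = (- fst x, cnj (snd x))"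

definition charts :: "(complex \<Rightarrow> rs_point) set" where
  "charts = {stereo_inv, stereo_inv_inf}"

lemma stereo_inv_inf_eq: "stereo_inv_inf w = antipodal_conj (stereo_inv w)"
  by (simp add: stereo_inv_inf_def stereo_inv_def antipodal_conj_def diff_divide_distrib)

lemma antipodal_conj_involution [simp]: "antipodal_conj (antipodal_conj x) = x"
  by (simp add: antipodal_conj_def)

lemma dist_antipodal_conj [simp]: "dist (antipodal_conj x) (antipodal_conj y) = dist x y"
  by (simp add: antipodal_conj_def dist_prod_def dist_norm power2_commute
      flip: complex_cnj_diff)

lemma norm_antipodal_conj [simp]: "norm (antipodal_conj x) = norm x"
  by (simp add: antipodal_conj_def norm_prod_def)

lemma mem_sphere_iff: "x \<in> riemann_sphere \<longleftrightarrow> (fst x)\<^sup>2 + (cmod (snd x))\<^sup>2 = 1"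
  by (cases x) (simp add: norm_prod_def real_sqrt_eq_1_iff)

lemma stereo_inv_mem: "stereo_inv z \<in> riemann_sphere"
proof -
  have pos: "cmod z ^ 2 + 1 > 0" by (simp add: add_nonneg_pos)
  then have "cmod (complex_of_real (2 / (cmod z ^ 2 + 1)) * z) = 2 / (cmod z ^ 2 + 1) * cmod z"
    unfolding norm_mult norm_of_real by simp
  moreover have "((r\<^sup>2 - 1) / (r\<^sup>2 + 1))\<^sup>2 + (2 / (r\<^sup>2 + 1) * r)\<^sup>2 = 1"
    if "r\<^sup>2 + 1 > 0" for r :: real
    using that by (simp add: power_divide power_mult_distrib divide_simps)
      (simp add: power2_eq_square algebra_simps)
  ultimately show ?thesis
    using pos unfolding mem_sphere_iff stereo_inv_def by simp
qed

lemma stereo_inv_fst_neq: "fst (stereo_inv z) \<noteq> 1"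
proof -
  have "cmod z ^ 2 + 1 > 0" by (simp add: add_nonneg_pos)
  then show ?thesis by (simp add: stereo_inv_def field_simps)
qed

lemma stereo_stereo_inv: "stereo (stereo_inv z) = z"
proof -
  have pos: "cmod z ^ 2 + 1 > 0" by (simp add: add_nonneg_pos)
  then have "1 - (cmod z ^ 2 - 1) / (cmod z ^ 2 + 1) = 2 / (cmod z ^ 2 + 1)"
    by (simp add: field_simps)
  moreover have "complex_of_real (2 / (cmod z ^ 2 + 1)) \<noteq> 0"
    using pos by (simp only: of_real_eq_0_iff) simp
  ultimately show ?thesis
    by (simp add: stereo_def stereo_inv_def del: of_real_divide)
qed

lemma stereo_inv_stereo:
  assumes "x \<in> riemann_sphere" "fst x \<noteq> 1"
  shows "stereo_inv (stereo x) = x"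
proof -
  obtain t w where x: "x = (t, w)" by (cases x)
  have "t\<^sup>2 + (cmod w)\<^sup>2 = 1" using assms(1) unfolding mem_sphere_iff x by simp
  moreover have "(1 - t) * (1 + t) = 1 - t\<^sup>2" by (simp add: power2_eq_square algebra_simps)
  ultimately have eq: "(cmod w)\<^sup>2 = (1 - t) * (1 + t)" by linarith
  have t: "1 - t \<noteq> 0" using assms by (simp add: x)
  have "cmod (stereo x) = cmod w / \<bar>1 - t\<bar>"
    unfolding stereo_def x norm_divide norm_of_real by simp
  then have "(cmod (stereo x))\<^sup>2 = (1 + t) / (1 - t)"
    unfolding power_divide power2_abs using eq t by (simp add: power2_eq_square)
  then have n1: "(cmod (stereo x))\<^sup>2 + 1 = 2 / (1 - t)" and n2: "(cmod (stereo x))\<^sup>2 - 1 = 2 * t / (1 - t)"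
    using t by (simp_all add: field_simps)
  have a: "((cmod (stereo x))\<^sup>2 - 1) / ((cmod (stereo x))\<^sup>2 + 1) = t"
    and b: "2 / ((cmod (stereo x))\<^sup>2 + 1) = 1 - t"
    unfolding n1 n2 using t by simp_all
  have "complex_of_real (1 - t) * (w / complex_of_real (1 - t)) = w"
    using t by (simp del: of_real_diff)
  then show ?thesis
    unfolding stereo_inv_def a b by (simp add: stereo_def x)
qed

lemma continuous_on_stereo_inv: "continuous_on UNIV stereo_inv"
proof -
  have "cmod z ^ 2 + 1 \<noteq> 0" for z :: complex
    using zero_le_power2[of "cmod z"] by linarith
  then show ?thesis
    unfolding stereo_inv_def by (intro continuous_intros) auto
qed

lemma chart_mem: "c \<in> charts \<Longrightarrow> c z \<in> riemann_sphere"
  using stereo_inv_mem by (auto simp: charts_def stereo_inv_inf_eq)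

lemma continuous_on_chart: "c \<in> charts \<Longrightarrow> continuous_on A c"
proof -
  have "continuous_on UNIV (\<lambda>w. antipodal_conj (stereo_inv w))"
    unfolding antipodal_conj_def
    by (intro continuous_intros continuous_on_stereo_inv)
  then have "continuous_on UNIV stereo_inv_inf"
    by (simp flip: stereo_inv_inf_eq)
  then show "c \<in> charts \<Longrightarrow> continuous_on A c"
    using continuous_on_stereo_inv continuous_on_subset[OF _ subset_UNIV] by (auto simp: charts_def)
qed

lemma inj_chart:
  assumes "c \<in> charts"
  shows "inj c"
proof -
  have "inj stereo_inv" by (rule inj_on_inverseI[of _ stereo]) (rule stereo_stereo_inv)
  moreover have "inj stereo_inv_inf"
    by (rule inj_on_inverseI[of _ "\<lambda>x. stereo (antipodal_conj x)"])
      (simp add: stereo_inv_inf_eq stereo_stereo_inv)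
  ultimately show ?thesis using assms by (auto simp: charts_def)
qed

lemma chart_cover:
  assumes "x \<in> riemann_sphere"
  obtains c z where "c \<in> charts" "c z = x"
proof (cases "fst x = 1")
  case False
  then show ?thesis using that[of stereo_inv "stereo x"] stereo_inv_stereo[OF assms] by (simp add: charts_def)
next
  case True
  have "antipodal_conj x \<in> riemann_sphere" "fst (antipodal_conj x) \<noteq> 1"
    using assms True by (auto simp: antipodal_conj_def norm_prod_def)
  then have "stereo_inv_inf (stereo (antipodal_conj x)) = x"
    by (simp add: stereo_inv_inf_eq stereo_inv_stereo)
  then show ?thesis using that[of stereo_inv_inf] by (auto simp: charts_def)
qed

text \<open>Holds because the inverse chart \<open>stereo\<close> is continuous off the pole. It
  turns facts about coordinate discs into facts about metric balls on the sphere.\<close>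

lemma chart_nhds:
  assumes c: "c \<in> charts" and N: "open N" "z \<in> N"
  obtains r where "r > 0" "riemann_sphere \<inter> ball (c z) r \<subseteq> c ` N"
proof -
  have base: "\<exists>r>0. riemann_sphere \<inter> ball (stereo_inv z) r \<subseteq> stereo_inv ` N"
  proof -
    define W where "W = {x :: rs_point. fst x \<noteq> 1}"
    have oW: "open W"
      unfolding W_def by (intro open_Collect_neq continuous_intros)
    have "continuous_on W stereo"
      unfolding stereo_def W_def
      by (intro continuous_intros) (simp add: of_real_eq_1_iff)
    then have "open (W \<inter> stereo -` N)"
      using oW N(1) by (subst Int_commute) (simp add: continuous_on_open_vimage)
    moreover have "stereo_inv z \<in> W \<inter> stereo -` N"
      using N(2) by (simp add: W_def stereo_inv_fst_neq stereo_stereo_inv)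
    ultimately obtain r where "r > 0" and r: "ball (stereo_inv z) r \<subseteq> W \<inter> stereo -` N"
      by (meson openE)
    have "riemann_sphere \<inter> ball (stereo_inv z) r \<subseteq> stereo_inv ` N"
    proof
      fix x assume "x \<in> riemann_sphere \<inter> ball (stereo_inv z) r"
      then have "stereo_inv (stereo x) = x" "stereo x \<in> N"
        using r stereo_inv_stereo[of x] by (auto simp: W_def)
      then show "x \<in> stereo_inv ` N" by (metis image_eqI)
    qed
    with \<open>r > 0\<close> show ?thesis by blast
  qed
  then obtain r where "r > 0" and r: "riemann_sphere \<inter> ball (stereo_inv z) r \<subseteq> stereo_inv ` N" by blast
  have "riemann_sphere \<inter> ball (stereo_inv_inf z) r \<subseteq> stereo_inv_inf ` N"
  proof
    fix x assume x: "x \<in> riemann_sphere \<inter> ball (stereo_inv_inf z) r"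
    then have "antipodal_conj x \<in> riemann_sphere \<inter> ball (stereo_inv z) r"
      using dist_antipodal_conj[of "stereo_inv_inf z" x]
      by (simp add: stereo_inv_inf_eq del: dist_antipodal_conj)
    then have "antipodal_conj x \<in> stereo_inv ` N" by (rule subsetD[OF r])
    then obtain w where "w \<in> N" "antipodal_conj x = stereo_inv w" by blast
    then show "x \<in> stereo_inv_inf ` N"
      by (metis antipodal_conj_involution image_eqI stereo_inv_inf_eq)
  qed
  with r \<open>r > 0\<close> c that show ?thesis by (auto simp: charts_def)
qed

lemma open_chart_vimage:
  assumes "c \<in> charts" "closed C"
  shows "open (c -` (riemann_sphere - C))"
proof -
  have "c -` (riemann_sphere - C) = - (c -` C)" using chart_mem[OF assms(1)] by auto
  moreover have "closed (c -` C)"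
    using assms continuous_on_chart[OF assms(1), of UNIV] by (simp add: continuous_on_closed_vimage)
  ultimately show ?thesis by (simp add: open_Compl)
qed

lemma continuous_on_via_charts:
  fixes f :: "rs_point \<Rightarrow> 'a::metric_space"
  assumes "closed C"
    and cont: "\<And>c. c \<in> charts \<Longrightarrow> continuous_on (c -` (riemann_sphere - C)) (\<lambda>z. f (c z))"
  shows "continuous_on (riemann_sphere - C) f"
  unfolding continuous_on_iff
proof (intro ballI allI impI)
  fix x and e :: real assume x: "x \<in> riemann_sphere - C" and "e > 0"
  obtain c z where c: "c \<in> charts" "c z = x" using chart_cover x by blast
  define V where "V = c -` (riemann_sphere - C)"
  have "open V" unfolding V_def by (rule open_chart_vimage[OF c(1) assms(1)])
  then have "open (V \<inter> (\<lambda>z. f (c z)) -` ball (f x) e)"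
    using cont[OF c(1)] unfolding V_def by (subst Int_commute) (simp add: continuous_on_open_vimage)
  moreover have "z \<in> V \<inter> (\<lambda>z. f (c z)) -` ball (f x) e"
    using c x \<open>e > 0\<close> by (simp add: V_def)
  ultimately obtain r where "r > 0"
    and r: "riemann_sphere \<inter> ball (c z) r \<subseteq> c ` (V \<inter> (\<lambda>z. f (c z)) -` ball (f x) e)"
    using chart_nhds[OF c(1)] by blast
  have "dist (f y) (f x) < e" if "y \<in> riemann_sphere - C" "dist y x < r" for y
  proof -
    have "y \<in> riemann_sphere \<inter> ball (c z) r" using that c by (auto simp: dist_commute)
    with r show ?thesis by (auto simp: dist_commute)
  qed
  with \<open>r > 0\<close> show "\<exists>d>0. \<forall>y\<in>riemann_sphere - C. dist y x < d \<longrightarrow> dist (f y) (f x) < e" by blast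
qed

section \<open>Simple poles\<close>

text \<open>Encoded by a reciprocal \<open>k\<close> with a simple zero: the value of
  \<open>f\<close> at \<open>\<zeta>\<close> does not enter, and pole behaviour becomes local
  injectivity and openness of \<open>k\<close>.\<close>

definition simple_pole :: "(complex \<Rightarrow> complex) \<Rightarrow> complex \<Rightarrow> bool" where
  "simple_pole f \<zeta> \<longleftrightarrow> (\<exists>k. k analytic_on {\<zeta>} \<and> k \<zeta> = 0 \<and> deriv k \<zeta> \<noteq> 0 \<and>
     (\<forall>\<^sub>F z in at \<zeta>. f z * k z = 1))"

lemma analytic_has_deriv: "f analytic_on {z} \<Longrightarrow> (f has_field_derivative deriv f z) (at z)"
  using analytic_on_imp_differentiable_at DERIV_deriv_iff_field_differentiable by blast

lemma deriv_quotient_simple_zero: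
  fixes N D :: "complex \<Rightarrow> complex"
  assumes "N analytic_on {\<zeta>}" "D analytic_on {\<zeta>}" "N \<zeta> = 0" "D \<zeta> \<noteq> 0"
  shows "deriv (\<lambda>z. N z / D z) \<zeta> = deriv N \<zeta> / D \<zeta>"
proof (rule DERIV_imp_deriv)
  have "((\<lambda>z. N z / D z) has_field_derivative
      (deriv N \<zeta> * D \<zeta> - N \<zeta> * deriv D \<zeta>) / (D \<zeta> * D \<zeta>)) (at \<zeta>)"
    by (rule DERIV_divide) (use assms analytic_has_deriv in auto)
  then show "((\<lambda>z. N z / D z) has_field_derivative deriv N \<zeta> / D \<zeta>) (at \<zeta>)"
    using assms by simp
qed

lemma analytic_eventually_neq:
  assumes "f analytic_on {\<zeta>}" "f \<zeta> \<noteq> a"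
  shows "\<forall>\<^sub>F z in at \<zeta>. f z \<noteq> a"
proof -
  have "(f \<longlongrightarrow> f \<zeta>) (at \<zeta>)"
    using analytic_at_imp_isCont[OF assms(1)] by (simp add: isCont_def)
  then show ?thesis using assms(2) by (rule tendsto_imp_eventually_ne)
qed

lemma simple_zero_eventually_neq:
  assumes "f analytic_on {\<zeta>}" "deriv f \<zeta> \<noteq> 0"
  shows "\<forall>\<^sub>F z in at \<zeta>. f z \<noteq> f \<zeta>"
proof -
  obtain S where S: "open S" "\<zeta> \<in> S" "f holomorphic_on S"
    using assms(1) analytic_at by blast
  obtain r where "r > 0" "inj_on f (ball \<zeta> r)"
    using has_complex_derivative_locally_injective[OF S(3,2,1) assms(2)] by metis
  then show ?thesis
    unfolding eventually_at by (intro exI[of _ r]) (auto simp: inj_on_def dist_commute)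
qed

text \<open>Near the pole of \<open>h\<close> the term \<open>b / (h - a)\<close> extends
  holomorphically with value 0, so the new reciprocal is \<open>k / D\<close> with
  \<open>D = 1\<close> at \<open>\<zeta>\<close>. This keeps the old punctures.\<close>

lemma simple_pole_add:
  assumes "simple_pole f \<zeta>" "simple_pole h \<zeta>"
  shows "simple_pole (\<lambda>z. f z + b / (h z - a)) \<zeta>"
proof -
  obtain k where k: "k analytic_on {\<zeta>}" "k \<zeta> = 0" "deriv k \<zeta> \<noteq> 0" "\<forall>\<^sub>F z in at \<zeta>. f z * k z = 1"
    using assms(1) unfolding simple_pole_def by blast
  obtain m where m: "m analytic_on {\<zeta>}" "m \<zeta> = 0" "\<forall>\<^sub>F z in at \<zeta>. h z * m z = 1"
    using assms(2) unfolding simple_pole_def by blast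
  define E where "E z = 1 - a * m z" for z
  define D where "D z = 1 + k z * b * m z / E z" for z
  have E: "E analytic_on {\<zeta>}" "E \<zeta> \<noteq> 0"
    unfolding E_def using m by (auto intro!: analytic_intros)
  then have D: "D analytic_on {\<zeta>}" "D \<zeta> \<noteq> 0"
    unfolding D_def using k m by (auto intro!: analytic_intros)
  have "\<forall>\<^sub>F z in at \<zeta>. (f z + b / (h z - a)) * (k z / D z) = 1"
    using k(4) m(3) analytic_eventually_neq[OF E] analytic_eventually_neq[OF D]
  proof eventually_elim
    case (elim z)
    have nz: "k z \<noteq> 0" "m z \<noteq> 0" using elim by auto
    have f: "f z = 1 / k z" and h: "h z = 1 / m z" using elim nz by (auto simp: field_simps)
    have "h z - a = E z / m z" using nz by (simp add: h E_def field_simps)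
    then have "f z + b / (h z - a) = D z / k z"
      using nz by (simp add: f D_def add_divide_distrib)
    then show ?case using nz elim by simp
  qed
  moreover have "(\<lambda>z. k z / D z) analytic_on {\<zeta>}" using k D by (auto intro!: analytic_intros)
  moreover have "deriv (\<lambda>z. k z / D z) \<zeta> \<noteq> 0"
    using deriv_quotient_simple_zero[OF k(1) D(1) k(2) D(2)] k D by simp
  ultimately show ?thesis unfolding simple_pole_def using k by (intro exI[of _ "\<lambda>z. k z / D z"]) auto
qed

text \<open>The sum is \<open>D / N\<close>, where \<open>N\<close> has a simple zero and
  \<open>D\<close> takes the value \<open>b\<close> at \<open>\<zeta>\<close>. This is the situation
  at a new puncture.\<close>

lemma simple_pole_new:
  assumes "f analytic_on {\<zeta>}" "g analytic_on {\<zeta>}" "deriv g \<zeta> \<noteq> 0" "b \<noteq> 0"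
  shows "simple_pole (\<lambda>z. f z + b / (g z - g \<zeta>)) \<zeta>"
proof -
  define N where "N z = g z - g \<zeta>" for z
  define D where "D z = N z * f z + b" for z
  have N: "N analytic_on {\<zeta>}" "N \<zeta> = 0" unfolding N_def using assms by (auto intro!: analytic_intros)
  have D: "D analytic_on {\<zeta>}" "D \<zeta> \<noteq> 0"
    unfolding D_def using assms N by (auto intro!: analytic_intros)
  have "(N has_field_derivative deriv g \<zeta> - 0) (at \<zeta>)"
    unfolding N_def by (intro derivative_intros analytic_has_deriv assms)
  then have dN: "deriv N \<zeta> = deriv g \<zeta>" by (simp add: DERIV_imp_deriv)
  have "\<forall>\<^sub>F z in at \<zeta>. (f z + b / (g z - g \<zeta>)) * (N z / D z) = 1"
    using simple_zero_eventually_neq[OF assms(2,3)]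
      analytic_eventually_neq[OF D]
  proof eventually_elim
    case (elim z)
    then have "N z \<noteq> 0" by (simp add: N_def)
    moreover from this have "f z + b / (g z - g \<zeta>) = D z / N z"
      by (simp add: D_def N_def field_simps)
    ultimately show ?case using elim by simp
  qed
  moreover have "(\<lambda>z. N z / D z) analytic_on {\<zeta>}" using N D by (auto intro!: analytic_intros)
  moreover have "deriv (\<lambda>z. N z / D z) \<zeta> \<noteq> 0"
    using deriv_quotient_simple_zero[OF N(1) D(1) N(2) D(2)] dN assms D by simp
  ultimately show ?thesis unfolding simple_pole_def using N by (intro exI[of _ "\<lambda>z. N z / D z"]) auto
qed

text \<open>All claims come from \<open>f = 1 / k\<close>: injectivity is that of \<open>k\<close>,
  large values are attained since \<open>k\<close> maps small discs onto neighbourhoods of 0, and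
  \<open>f\<close> is large where \<open>k\<close> is small.\<close>

lemma simple_pole_local:
  assumes "simple_pole f \<zeta>"
  obtains R where "R > 0"
    "inj_on f (ball \<zeta> R - {\<zeta>})"
    "\<And>s. 0 < s \<Longrightarrow> \<exists>A. \<forall>a. cmod a \<ge> A \<longrightarrow> a \<in> f ` (ball \<zeta> s - {\<zeta>})"
    "\<And>B. \<exists>s>0. \<forall>z \<in> ball \<zeta> s - {\<zeta>}. cmod (f z) \<ge> B"
proof -
  obtain k where k: "k analytic_on {\<zeta>}" "k \<zeta> = 0" "deriv k \<zeta> \<noteq> 0" "\<forall>\<^sub>F z in at \<zeta>. f z * k z = 1"
    using assms(1) unfolding simple_pole_def by blast
  obtain S where S: "open S" "\<zeta> \<in> S" "k holomorphic_on S"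
    using k(1) analytic_at by blast
  obtain r1 where r1: "r1 > 0" "ball \<zeta> r1 \<subseteq> S" "inj_on k (ball \<zeta> r1)"
    using has_complex_derivative_locally_injective[OF S(3,2,1) k(3)] by metis
  obtain r2 where r2: "r2 > 0" "\<And>z. z \<noteq> \<zeta> \<Longrightarrow> dist z \<zeta> < r2 \<Longrightarrow> f z * k z = 1"
    using k(4) unfolding eventually_at by auto
  define R where "R = min r1 r2"
  have inv: "k z \<noteq> 0 \<and> f z = 1 / k z" if "z \<in> ball \<zeta> R - {\<zeta>}" for z
  proof -
    have "f z * k z = 1" using that r2(2)[of z] by (auto simp: R_def dist_commute)
    then have "k z \<noteq> 0" by auto
    with \<open>f z * k z = 1\<close> show ?thesis by (simp add: field_simps)
  qed
  have injk: "inj_on k (ball \<zeta> R)" using r1(3) by (rule inj_on_subset) (auto simp: R_def)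
  show ?thesis
  proof
    show "R > 0" using r1 r2 by (simp add: R_def)
    show "inj_on f (ball \<zeta> R - {\<zeta>})"
    proof (rule inj_onI)
      fix x y assume xy: "x \<in> ball \<zeta> R - {\<zeta>}" "y \<in> ball \<zeta> R - {\<zeta>}" "f x = f y"
      then have "k x = k y" using inv[of x] inv[of y] by auto
      then show "x = y" using injk xy by (auto dest: inj_onD)
    qed
  next
    fix s :: real assume "0 < s"
    define t where "t = min s R"
    have t: "t > 0" "ball \<zeta> t \<subseteq> ball \<zeta> R" "ball \<zeta> t \<subseteq> ball \<zeta> s" "ball \<zeta> t \<subseteq> ball \<zeta> r1"
      using \<open>0 < s\<close> \<open>r1 > 0\<close> \<open>r2 > 0\<close> by (auto simp: t_def R_def)
    have "open (k ` ball \<zeta> t)"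
    proof (rule open_mapping_thm3)
      show "k holomorphic_on ball \<zeta> t" using S(3) t r1(2) by (meson holomorphic_on_subset subset_trans)
      show "inj_on k (ball \<zeta> t)" using injk t by (meson inj_on_subset)
    qed simp
    moreover have "0 \<in> k ` ball \<zeta> t" using k(2) t(1) by (metis centre_in_ball image_eqI)
    ultimately obtain e where "e > 0" and e: "ball 0 e \<subseteq> k ` ball \<zeta> t" by (meson openE)
    show "\<exists>A. \<forall>a. cmod a \<ge> A \<longrightarrow> a \<in> f ` (ball \<zeta> s - {\<zeta>})"
    proof (intro exI allI impI)
      fix a assume a: "1 / e + 1 \<le> cmod a"
      have "1 / e > 0" using \<open>e > 0\<close> by simp
      then have "cmod a > 0" "cmod a > 1 / e" using a by linarith+
      then have "1 / cmod a < e" using \<open>e > 0\<close> by (simp add: field_simps)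
      then have "1 / a \<in> ball 0 e" by (simp add: norm_divide)
      then obtain z where z: "z \<in> ball \<zeta> t" "k z = 1 / a" using e by (metis imageE subsetD)
      then have "z \<noteq> \<zeta>" using \<open>cmod a > 0\<close> k(2) by auto
      then have "f z = a" using z t inv[of z] by auto
      then show "a \<in> f ` (ball \<zeta> s - {\<zeta>})" using z t \<open>z \<noteq> \<zeta>\<close> by blast
    qed
  next
    fix B :: real
    have "isCont k \<zeta>" using k(1) by (rule analytic_at_imp_isCont)
    then obtain d where d: "d > 0" "\<And>z. dist z \<zeta> < d \<Longrightarrow> dist (k z) (k \<zeta>) < 1 / (\<bar>B\<bar> + 1)"
      unfolding continuous_at_eps_delta by (metis abs_ge_zero add_nonneg_pos zero_less_one zero_less_divide_1_iff)
    show "\<exists>s>0. \<forall>z \<in> ball \<zeta> s - {\<zeta>}. cmod (f z) \<ge> B"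
    proof (intro exI[of _ "min d R"] conjI ballI)
      show "min d R > 0" using d r1 r2 by (auto simp: R_def)
      fix z assume z: "z \<in> ball \<zeta> (min d R) - {\<zeta>}"
      then have i: "k z \<noteq> 0" "f z = 1 / k z" using inv[of z] by auto
      have "cmod (k z) < 1 / (\<bar>B\<bar> + 1)" using d(2)[of z] z k(2) by (auto simp: dist_commute)
      then have "\<bar>B\<bar> + 1 < 1 / cmod (k z)" using i by (simp add: field_simps)
      then show "B \<le> cmod (f z)" by (simp add: i norm_divide)
    qed
  qed
qed

section \<open>Shears\<close>

text \<open>The form \<open>lin n\<close> vanishes on the shear direction \<open>(slope n, 1)\<close> and, the slopes
  being distinct, on no other one.\<close>

definition slope :: "nat \<Rightarrow> complex" where
  "slope n = complex_of_real (1 / real (Suc n))"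

definition lin :: "nat \<Rightarrow> complex \<times> complex \<Rightarrow> complex" where
  "lin n p = fst p - slope n * snd p"

definition shear :: "nat \<Rightarrow> complex \<Rightarrow> complex \<Rightarrow> complex \<times> complex \<Rightarrow> complex \<times> complex" where
  "shear n a e p = (fst p + slope n * (e / (lin n p - a)), snd p + e / (lin n p - a))"

lemma slope_eq_iff [simp]: "slope m = slope n \<longleftrightarrow> m = n"
  by (simp add: slope_def del: of_nat_Suc)

lemma cmod_slope_le_1: "cmod (slope n) \<le> 1"
  unfolding slope_def norm_of_real by (simp add: field_simps)

lemma lin_diff: "lin n (p - p') = lin n p - lin n p'"
  by (simp add: lin_def algebra_simps)

lemma cmod_lin_le: "cmod (lin n p) \<le> 2 * norm p"
proof -
  have "cmod (lin n p) \<le> cmod (fst p) + cmod (slope n) * cmod (snd p)"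
    unfolding lin_def using norm_triangle_ineq4 by (metis norm_mult)
  also have "\<dots> \<le> norm p + 1 * norm p"
    using cmod_slope_le_1 norm_fst_le[of "fst p" "snd p"] norm_snd_le[of "snd p" "fst p"]
    by (intro add_mono mult_mono) auto
  finally show ?thesis by simp
qed

lemma norm_along_slope_le: "norm (slope n * t, t) \<le> 2 * cmod t"
proof -
  have "norm (slope n * t, t) \<le> cmod (slope n) * cmod t + cmod t"
    using norm_Pair_le[of "slope n * t" t] by (simp add: norm_mult)
  also have "\<dots> \<le> 1 * cmod t + cmod t"
    using cmod_slope_le_1 by (intro add_mono mult_right_mono) auto
  finally show ?thesis by simp
qed

lemma shear_eq: "shear n a e p = p + (slope n * (e / (lin n p - a)), e / (lin n p - a))"
  by (simp add: shear_def prod_eq_iff)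

text \<open>For \<open>m = n\<close> the correction vanishes, so the displacement can be read off
  the image; this gives \<open>shear_inj\<close>. For \<open>m \<noteq> n\<close> the factor is
  nonzero, which creates the poles of the later forms.\<close>

lemma lin_shear: "lin m (shear n a e p) = lin m p + ((slope n - slope m) * e) / (lin n p - a)"
  by (simp add: lin_def shear_def algebra_simps diff_divide_distrib)

lemma shear_inj: "shear n a e p = shear n a e p' \<Longrightarrow> p = p'"
  using lin_shear[of n n a e p] lin_shear[of n n a e p'] by (simp add: shear_eq)

lemma dist_shear_le:
  assumes "1 \<le> cmod (lin n p - a)"
  shows "dist (shear n a e p) p \<le> 2 * cmod e"
proof -
  have "dist (shear n a e p) p \<le> 2 * cmod (e / (lin n p - a))"
    using norm_along_slope_le[of n "e / (lin n p - a)"]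
    by (simp add: dist_norm shear_eq del: times_divide_eq_right)
  also have "cmod (e / (lin n p - a)) \<le> cmod e"
    using assms by (simp add: norm_divide divide_le_eq mult_le_cancel_left1)
  finally show ?thesis by simp
qed

text \<open>Valid arbitrarily close to the singular line. If \<open>lin n p\<close> is within 1 of
  \<open>a\<close>, its modulus is at least \<open>2 * R\<close>; the shear preserves it, so the
  image has norm at least \<open>R\<close>. Otherwise the shear moves \<open>p\<close> by at most
  \<open>2 * cmod e\<close>.\<close>

lemma norm_shear_ge:
  assumes "2 * R + 1 \<le> cmod a"
  shows "min (norm p) R - 2 * cmod e \<le> norm (shear n a e p)"
proof (cases "1 \<le> cmod (lin n p - a)")
  case True
  then show ?thesis
    using dist_shear_le[OF True, of e] norm_triangle_sub[of p "shear n a e p"]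
    by (simp add: dist_norm norm_minus_commute)
next
  case False
  have "cmod a \<le> cmod (lin n p) + cmod (lin n p - a)"
    using norm_triangle_sub[of a "lin n p"] by (simp add: norm_minus_commute)
  moreover have "cmod (lin n p) \<le> 2 * norm (shear n a e p)"
    using cmod_lin_le[of n "shear n a e p"] by (simp add: lin_shear)
  ultimately have "R \<le> norm (shear n a e p)" using False assms by linarith
  then show ?thesis using norm_ge_zero[of e] by linarith
qed

text \<open>For arguments at distance at least 1 from \<open>a\<close>, differences of
  \<open>1 / (t - a)\<close> are bounded by those of \<open>t\<close>. The factors 2 of
  \<open>cmod_lin_le\<close> and \<open>norm_along_slope_le\<close> make up the 4.\<close>

lemma dist_shear_ge:
  assumes "1 \<le> cmod (lin n p - a)" "1 \<le> cmod (lin n p' - a)"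
  shows "(1 - 4 * cmod e) * dist p p' \<le> dist (shear n a e p) (shear n a e p')"
proof -
  define t where "t = e / (lin n p - a) - e / (lin n p' - a)"
  have nz: "lin n p - a \<noteq> 0" "lin n p' - a \<noteq> 0" using assms by auto
  have "t = e * lin n (p' - p) / ((lin n p - a) * (lin n p' - a))"
    using nz by (simp add: t_def lin_diff field_simps)
  then have "cmod t = cmod e * cmod (lin n (p' - p)) / (cmod (lin n p - a) * cmod (lin n p' - a))"
    by (simp add: norm_divide norm_mult)
  also have "\<dots> \<le> cmod e * cmod (lin n (p' - p)) / 1"
  proof (rule divide_left_mono)
    show "1 \<le> cmod (lin n p - a) * cmod (lin n p' - a)"
      using mult_mono[OF assms] by simp
  qed (use nz in auto)
  also have "\<dots> \<le> cmod e * (2 * dist p p')"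
    using cmod_lin_le[of n "p' - p"] by (simp add: mult_left_mono dist_norm norm_minus_commute)
  finally have "norm (slope n * t, t) \<le> 4 * cmod e * dist p p'"
    using norm_along_slope_le[of n t] by linarith
  moreover have "p - p' = (shear n a e p - shear n a e p') - (slope n * t, t)"
    by (simp add: shear_def t_def prod_eq_iff algebra_simps)
  then have "norm (p - p') \<le> norm (shear n a e p - shear n a e p') + norm (slope n * t, t)"
    by (metis norm_triangle_ineq4)
  ultimately show ?thesis by (simp add: dist_norm algebra_simps)
qed

section \<open>Poles on the sphere, read in a chart\<close>

lemma chart_pole_inj:
  assumes "c \<in> charts" "simple_pole (\<lambda>z. h (c z)) \<zeta>"
  shows "\<forall>\<^sub>F r in at_right 0. inj_on h (riemann_sphere \<inter> cball (c \<zeta>) r - {c \<zeta>})"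
proof -
  obtain R where R: "R > 0" "inj_on (\<lambda>z. h (c z)) (ball \<zeta> R - {\<zeta>})"
    using simple_pole_local[OF assms(2)] by metis
  obtain s where s: "s > 0" "riemann_sphere \<inter> ball (c \<zeta>) s \<subseteq> c ` ball \<zeta> R"
    using chart_nhds[OF assms(1), of "ball \<zeta> R" \<zeta>] R(1) by auto
  have "inj_on h (riemann_sphere \<inter> cball (c \<zeta>) r - {c \<zeta>})" if "r < s" for r
  proof (rule inj_onI)
    fix x y
    assume x: "x \<in> riemann_sphere \<inter> cball (c \<zeta>) r - {c \<zeta>}"
      and y: "y \<in> riemann_sphere \<inter> cball (c \<zeta>) r - {c \<zeta>}" and eq: "h x = h y"
    have "x \<in> c ` ball \<zeta> R" "y \<in> c ` ball \<zeta> R" using x y that s(2) by fastforce+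
    then obtain u v where "u \<in> ball \<zeta> R" "x = c u" "v \<in> ball \<zeta> R" "y = c v" by blast
    with x y eq inj_onD[OF R(2), of u v] show "x = y" by auto
  qed
  then show ?thesis using s(1) unfolding eventually_at_right_field by (auto intro!: exI[of _ s])
qed

lemma chart_pole_large:
  assumes "c \<in> charts" "simple_pole (\<lambda>z. h (c z)) \<zeta>"
  shows "\<forall>\<^sub>F r in at_right 0. \<forall>x \<in> riemann_sphere \<inter> cball (c \<zeta>) r - {c \<zeta>}. B \<le> cmod (h x)"
proof -
  obtain R where R: "R > 0" "\<forall>z \<in> ball \<zeta> R - {\<zeta>}. B \<le> cmod (h (c z))"
    using simple_pole_local[OF assms(2)] by metis
  obtain s where s: "s > 0" "riemann_sphere \<inter> ball (c \<zeta>) s \<subseteq> c ` ball \<zeta> R"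
    using chart_nhds[OF assms(1), of "ball \<zeta> R" \<zeta>] R(1) by auto
  have "B \<le> cmod (h x)" if "r < s" "x \<in> riemann_sphere \<inter> cball (c \<zeta>) r - {c \<zeta>}" for r x
  proof -
    have "x \<in> c ` ball \<zeta> R" using that s(2) by fastforce
    with that R(2) show ?thesis by auto
  qed
  then show ?thesis using s(1) unfolding eventually_at_right_field by (blast intro!: exI[of _ s])
qed

text \<open>Restricting to real values \<open>t\<close> makes \<open>at_top\<close> available, so
  that one common value can be chosen for finitely many punctures.\<close>

lemma chart_pole_surj:
  assumes "c \<in> charts" "simple_pole (\<lambda>z. h (c z)) \<zeta>" "0 < s"
  shows "\<forall>\<^sub>F t in at_top. \<exists>x \<in> riemann_sphere \<inter> ball (c \<zeta>) s - {c \<zeta>}. h x = complex_of_real t"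
proof -
  have "isCont c \<zeta>" using continuous_on_chart[OF assms(1), of UNIV] by (simp add: continuous_on_eq_continuous_at)
  then obtain d where d: "d > 0" "\<And>z. dist z \<zeta> < d \<Longrightarrow> dist (c z) (c \<zeta>) < s"
    unfolding continuous_at_eps_delta using assms(3) by blast
  obtain A where A: "\<forall>a. A \<le> cmod a \<longrightarrow> a \<in> (\<lambda>z. h (c z)) ` (ball \<zeta> d - {\<zeta>})"
    using simple_pole_local[OF assms(2)] d(1) by metis
  have "\<exists>x \<in> riemann_sphere \<inter> ball (c \<zeta>) s - {c \<zeta>}. h x = complex_of_real t" if "\<bar>A\<bar> \<le> t" for t
  proof -
    have "A \<le> cmod (complex_of_real t)" using that by simp
    then have "complex_of_real t \<in> (\<lambda>z. h (c z)) ` (ball \<zeta> d - {\<zeta>})" using A by blast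
    then obtain z where z: "z \<in> ball \<zeta> d - {\<zeta>}" "h (c z) = complex_of_real t" by (metis imageE)
    then have "c z \<noteq> c \<zeta>" using inj_chart[OF assms(1)] by (auto dest: injD)
    then show ?thesis
      using z d(2)[of z] chart_mem[OF assms(1)] by (intro bexI[of _ "c z"]) (auto simp: dist_commute)
  qed
  then show ?thesis unfolding eventually_at_top_linorder by blast
qed

text \<open>All forms \<open>lin m\<close> of later steps must keep the pole, and in one common chart, so that
  \<open>simple_pole_add\<close> applies to two of them.\<close>

definition has_poles :: "nat \<Rightarrow> (rs_point \<Rightarrow> complex \<times> complex) \<Rightarrow> rs_point \<Rightarrow> bool" where
  "has_poles n G p \<longleftrightarrow> (\<exists>c\<in>charts. \<exists>\<zeta>. c \<zeta> = p \<and> (\<forall>m\<ge>n. simple_pole (\<lambda>z. lin m (G (c z))) \<zeta>))"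

definition hol_pair :: "(rs_point \<Rightarrow> complex \<times> complex) \<Rightarrow> rs_point set \<Rightarrow> bool" where
  "hol_pair G U \<longleftrightarrow> (\<forall>c\<in>charts. (\<lambda>z. fst (G (c z))) holomorphic_on (c -` U) \<and>
      (\<lambda>z. snd (G (c z))) holomorphic_on (c -` U))"

definition immersive :: "(rs_point \<Rightarrow> complex \<times> complex) \<Rightarrow> rs_point set \<Rightarrow> bool" where
  "immersive G U \<longleftrightarrow> (\<forall>c\<in>charts. \<forall>z\<in>c -` U. deriv (\<lambda>z. fst (G (c z))) z \<noteq> 0 \<or>
      deriv (\<lambda>z. snd (G (c z))) z \<noteq> 0)"

definition punctured_embedding :: "nat \<Rightarrow> (rs_point \<Rightarrow> complex \<times> complex) \<Rightarrow> rs_point set \<Rightarrow> bool" where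
  "punctured_embedding n G P \<longleftrightarrow>
     finite P \<and> card P \<le> 2 ^ n \<and> P \<subseteq> riemann_sphere \<and>
     hol_pair G (riemann_sphere - P) \<and> inj_on G (riemann_sphere - P) \<and>
     immersive G (riemann_sphere - P) \<and> (\<forall>p\<in>P. has_poles n G p)"

text \<open>The size bound serves the dimension, disjointness the tree of discs, and largeness of
  \<open>G\<close> properness; the 1 in \<open>real n + 1\<close> pays for the loss of norm in all
  later steps. Injectivity of \<open>lin n\<close> lets the line \<open>lin n = a\<close> meet the
  curve at most once in each disc, and with a simple zero.\<close>

definition good_radius :: "nat \<Rightarrow> (rs_point \<Rightarrow> complex \<times> complex) \<Rightarrow> rs_point set \<Rightarrow> real \<Rightarrow> bool" where
  "good_radius n G P r \<longleftrightarrow>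
     0 < r \<and> 6 * r \<le> (1/2) ^ (n * n) \<and> (\<forall>p\<in>P. \<forall>p'\<in>P. p \<noteq> p' \<longrightarrow> 2 * r < dist p p') \<and>
     (\<forall>p\<in>P. \<forall>x \<in> riemann_sphere \<inter> cball p r - {p}. real n + 1 \<le> norm (G x)) \<and>
     (\<forall>p\<in>P. inj_on (\<lambda>x. lin n (G x)) (riemann_sphere \<inter> cball p r - {p}))"

lemma eventually_at_right_0_less:
  fixes b :: real assumes "0 < b" shows "\<forall>\<^sub>F r in at_right 0. r < b"
  unfolding eventually_at_right_field using assms by blast

text \<open>Each clause holds for all small radii and there are finitely many punctures. The
  eventual form can be combined with the nesting condition on the next radius.\<close>

lemma eventually_good_radius:
  assumes "punctured_embedding n G P"
  shows "\<forall>\<^sub>F r in at_right 0. good_radius n G P r"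
proof -
  have fin: "finite P" using assms by (simp add: punctured_embedding_def)
  have poles: "\<exists>c\<in>charts. \<exists>\<zeta>. c \<zeta> = p \<and> simple_pole (\<lambda>z. lin n (G (c z))) \<zeta>" if "p \<in> P" for p
    using assms that unfolding punctured_embedding_def has_poles_def by blast
  have 1: "\<forall>\<^sub>F r in at_right 0. (0::real) < r" by (rule eventually_at_right_less)
  have 2: "\<forall>\<^sub>F r in at_right 0. 6 * r \<le> (1/2 :: real) ^ (n * n)"
    by (rule eventually_mono[OF eventually_at_right_0_less[of "(1/2) ^ (n * n) / 6"]]) auto
  have 3: "\<forall>\<^sub>F r in at_right 0. \<forall>p\<in>P. \<forall>p'\<in>P. p \<noteq> p' \<longrightarrow> 2 * r < dist p p'"
  proof (intro eventually_ball_finite fin ballI)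
    fix p p' assume "p \<in> P" "p' \<in> P"
    show "\<forall>\<^sub>F r in at_right 0. p \<noteq> p' \<longrightarrow> 2 * r < dist p p'"
    proof (cases "p = p'")
      case False
      then show ?thesis
        by (intro eventually_mono[OF eventually_at_right_0_less[of "dist p p' / 2"]]) auto
    qed simp
  qed
  have 4: "\<forall>\<^sub>F r in at_right 0. \<forall>p\<in>P. \<forall>x \<in> riemann_sphere \<inter> cball p r - {p}. real n + 1 \<le> norm (G x)"
  proof (intro eventually_ball_finite fin ballI)
    fix p assume "p \<in> P"
    then obtain c \<zeta> where c: "c \<in> charts" "c \<zeta> = p" "simple_pole (\<lambda>z. lin n (G (c z))) \<zeta>" using poles by blast
    show "\<forall>\<^sub>F r in at_right 0. \<forall>x \<in> riemann_sphere \<inter> cball p r - {p}. real n + 1 \<le> norm (G x)"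
      using chart_pole_large[OF c(1), of "\<lambda>x. lin n (G x)" \<zeta> "2 * (real n + 1)", OF c(3)] unfolding c(2)
    proof eventually_elim
      case (elim r)
      show ?case
      proof
        fix x assume "x \<in> riemann_sphere \<inter> cball p r - {p}"
        then have "2 * (real n + 1) \<le> cmod (lin n (G x))" using elim by blast
        from order_trans[OF this cmod_lin_le] show "real n + 1 \<le> norm (G x)" by simp
      qed
    qed
  qed
  have 5: "\<forall>\<^sub>F r in at_right 0. \<forall>p\<in>P. inj_on (\<lambda>x. lin n (G x)) (riemann_sphere \<inter> cball p r - {p})"
  proof (intro eventually_ball_finite fin ballI)
    fix p assume "p \<in> P"
    then obtain c \<zeta> where c: "c \<in> charts" "c \<zeta> = p" "simple_pole (\<lambda>z. lin n (G (c z))) \<zeta>" using poles by blast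
    show "\<forall>\<^sub>F r in at_right 0. inj_on (\<lambda>x. lin n (G x)) (riemann_sphere \<inter> cball p r - {p})"
      using chart_pole_inj[OF c(1), of "\<lambda>x. lin n (G x)" \<zeta>, OF c(3)] unfolding c(2) .
  qed
  show ?thesis
    using 1 2 3 4 5 by eventually_elim (simp add: good_radius_def)
qed

section \<open>Holomorphy and immersivity in the charts, and their behaviour under shears\<close>

lemma hol_pair_continuous_on:
  assumes "hol_pair G (riemann_sphere - C)" "closed C"
  shows "continuous_on (riemann_sphere - C) G"
proof (rule continuous_on_via_charts[OF assms(2)])
  fix c assume "c \<in> charts"
  then have "continuous_on (c -` (riemann_sphere - C)) (\<lambda>z. (fst (G (c z)), snd (G (c z))))"
    using assms(1) unfolding hol_pair_def
    by (intro continuous_on_Pair holomorphic_on_imp_continuous_on) auto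
  then show "continuous_on (c -` (riemann_sphere - C)) (\<lambda>z. G (c z))" by simp
qed

lemma hol_pair_lin:
  assumes "hol_pair G U" "c \<in> charts"
  shows "(\<lambda>z. lin n (G (c z))) holomorphic_on c -` U"
  using assms unfolding hol_pair_def lin_def by (intro holomorphic_intros) auto

lemma hol_pair_subset: "hol_pair G U \<Longrightarrow> V \<subseteq> U \<Longrightarrow> hol_pair G V"
  unfolding hol_pair_def by (meson holomorphic_on_subset vimage_mono)

lemma hol_pair_shear:
  assumes "hol_pair G U" "\<And>x. x \<in> U \<Longrightarrow> lin n (G x) \<noteq> a"
  shows "hol_pair (\<lambda>x. shear n a e (G x)) U"
  unfolding hol_pair_def shear_def
  using assms(1) hol_pair_lin[OF assms(1)] assms(2) unfolding hol_pair_def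
  by (auto intro!: holomorphic_intros)

text \<open>If the sheared curve had derivative 0, that of \<open>G\<close> would be
  \<open>- T'\<close> times the direction \<open>(slope n, 1)\<close>, which \<open>lin n\<close>
  kills. But \<open>T'\<close> is a multiple of the derivative of \<open>lin n \<circ> G\<close>, so
  \<open>T' = 0\<close> and \<open>G\<close> itself would be singular.\<close>

lemma immersive_shear:
  assumes hol: "hol_pair G (riemann_sphere - C)" and "closed C"
    and ne: "\<And>x. x \<in> riemann_sphere - C \<Longrightarrow> lin n (G x) \<noteq> a"
    and imm: "immersive G (riemann_sphere - C)"
  shows "immersive (\<lambda>x. shear n a e (G x)) (riemann_sphere - C)"
  unfolding immersive_def
proof (intro ballI)
  fix c z assume c: "c \<in> charts" and z: "z \<in> c -` (riemann_sphere - C)"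
  define F where "F z = fst (G (c z))" for z
  define H where "H z = snd (G (c z))" for z
  define k where "k = slope n"
  define d where "d z = F z - k * H z - a" for z
  have op: "open (c -` (riemann_sphere - C))" by (rule open_chart_vimage[OF c assms(2)])
  have "F holomorphic_on c -` (riemann_sphere - C)" "H holomorphic_on c -` (riemann_sphere - C)"
    using hol c unfolding hol_pair_def F_def H_def by auto
  then have D: "(F has_field_derivative deriv F z) (at z)" "(H has_field_derivative deriv H z) (at z)"
    using holomorphic_derivI[OF _ op z] by auto
  have nz: "d z \<noteq> 0" using ne[of "c z"] z by (simp add: d_def F_def H_def k_def lin_def)
  define T' where "T' = - e * (deriv F z - k * deriv H z) / (d z)\<^sup>2"
  have "((\<lambda>z. e / d z) has_field_derivative T') (at z)"
    unfolding d_def T'_def using nz D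
    by (auto intro!: derivative_eq_intros simp: d_def power2_eq_square)
  note T = this
  have "((\<lambda>z. F z + k * (e / d z)) has_field_derivative deriv F z + k * T') (at z)"
    "((\<lambda>z. H z + e / d z) has_field_derivative deriv H z + T') (at z)"
    by (intro derivative_intros D T DERIV_cmult)+
  moreover have "(\<lambda>z. fst (shear n a e (G (c z)))) = (\<lambda>z. F z + k * (e / d z))"
    "(\<lambda>z. snd (shear n a e (G (c z)))) = (\<lambda>z. H z + e / d z)"
    by (auto simp: shear_def lin_def F_def H_def d_def k_def)
  ultimately have eqs: "deriv (\<lambda>z. fst (shear n a e (G (c z)))) z = deriv F z + k * T'"
    "deriv (\<lambda>z. snd (shear n a e (G (c z)))) z = deriv H z + T'"
    by (simp_all add: DERIV_imp_deriv)
  have "deriv F z \<noteq> 0 \<or> deriv H z \<noteq> 0"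
    using imm c z unfolding immersive_def F_def H_def by blast
  moreover have "deriv F z = 0 \<and> deriv H z = 0" if "deriv F z + k * T' = 0" "deriv H z + T' = 0"
  proof -
    have "deriv F z = - k * T'" "deriv H z = - T'"
      using that by (simp_all add: eq_neg_iff_add_eq_0)
    moreover from this have "deriv F z - k * deriv H z = 0" by simp
    then have "T' = 0" unfolding T'_def by simp
    ultimately show ?thesis by simp
  qed
  ultimately show "deriv (\<lambda>z. fst (shear n a e (G (c z)))) z \<noteq> 0 \<or>
      deriv (\<lambda>z. snd (shear n a e (G (c z)))) z \<noteq> 0"
    unfolding eqs by blast
qed

section \<open>Splitting the punctures\<close>

text \<open>At \<open>w = 0\<close> both sides are 0 by the convention on division by zero.\<close>

lemma stereo_stereo_inv_inf: "stereo (stereo_inv_inf w) = inverse w"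
proof (cases "w = 0")
  case True
  then show ?thesis by (simp add: stereo_def stereo_inv_inf_def)
next
  case False
  define r where "r = (cmod w)\<^sup>2"
  have r: "r > 0" using False by (simp add: r_def)
  have scale: "complex_of_real u * z / complex_of_real v = z * complex_of_real (u / v)" for u v z
    by simp
  have "1 - (1 - r) / (r + 1) = 2 * r / (r + 1)" using r by (simp add: field_simps)
  then have "stereo (stereo_inv_inf w) = complex_of_real (2 / (r + 1)) * cnj w / complex_of_real (2 * r / (r + 1))"
    unfolding stereo_def stereo_inv_inf_def r_def[symmetric] by simp
  also have "\<dots> = cnj w * complex_of_real ((2 / (r + 1)) / (2 * r / (r + 1)))"
    by (rule scale)
  also have "(2 / (r + 1)) / (2 * r / (r + 1)) = 1 / r"
    using r by (simp add: divide_simps)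
  also have "cnj w * complex_of_real (1 / r) = cnj w / (w * cnj w)"
    unfolding r_def by (simp only: complex_norm_square of_real_divide of_real_1) simp
  also have "\<dots> = inverse w" using False by (simp add: inverse_eq_divide)
  finally show ?thesis .
qed

text \<open>Since the second component is 0, every form \<open>lin m\<close> equals
  \<open>1 / w\<close> near infinity, and the identity is a reciprocal for all \<open>m\<close> at
  once.\<close>

lemma stereo_punctured_embedding:
  "punctured_embedding 0 (\<lambda>x. (stereo x, 0)) {(1, 0)}"
proof -
  let ?U = "riemann_sphere - {(1, 0)}"
  have inf0: "stereo_inv_inf 0 = (1, 0)" by (simp add: stereo_inv_inf_def)
  have U: "w \<noteq> 0" if "w \<in> stereo_inv_inf -` ?U" for w using that inf0 by (metis DiffD2 singletonI vimage_eq)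
  have dinv: "(inverse has_field_derivative - inverse (w * w)) (at w)" if "w \<noteq> 0" for w :: complex
    using that by (auto intro!: derivative_eq_intros simp: power2_eq_square)
  have "hol_pair (\<lambda>x. (stereo x, 0)) ?U"
  proof -
    have "(\<lambda>w. inverse w) holomorphic_on stereo_inv_inf -` ?U"
      using U by (intro holomorphic_on_inverse holomorphic_on_ident)
    then show ?thesis
      unfolding hol_pair_def charts_def
      by (simp add: stereo_stereo_inv stereo_stereo_inv_inf holomorphic_on_const holomorphic_on_ident)
  qed
  moreover have "immersive (\<lambda>x. (stereo x, 0)) ?U"
  proof -
    have "deriv inverse w \<noteq> 0" if "w \<in> stereo_inv_inf -` ?U" for w
      using DERIV_imp_deriv[OF dinv[OF U[OF that]]] U[OF that] by simp
    then show ?thesis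
      unfolding immersive_def charts_def by (simp add: stereo_stereo_inv stereo_stereo_inv_inf)
  qed
  moreover have "inj_on (\<lambda>x. (stereo x, 0 :: complex)) ?U"
  proof (rule inj_onI)
    fix x y assume xy: "x \<in> ?U" "y \<in> ?U" "(stereo x, 0 :: complex) = (stereo y, 0)"
    have "fst z \<noteq> 1" if "z \<in> ?U" for z
    proof
      assume 1: "fst z = 1"
      have "(fst z)\<^sup>2 + (cmod (snd z))\<^sup>2 = 1" using that mem_sphere_iff by blast
      with 1 have "snd z = 0" by simp
      then show False using that 1 by (simp add: prod_eq_iff)
    qed
    then have "stereo_inv (stereo x) = x" "stereo_inv (stereo y) = y"
      using xy(1,2) by (simp_all add: stereo_inv_stereo)
    then show "x = y" using xy(3) by (metis prod.inject)
  qed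
  moreover have "has_poles 0 (\<lambda>x. (stereo x, 0)) (1, 0)"
    unfolding has_poles_def
  proof (intro bexI exI conjI allI impI)
    show "stereo_inv_inf 0 = (1, 0)" by (rule inf0)
    show "stereo_inv_inf \<in> charts" by (simp add: charts_def)
    show "simple_pole (\<lambda>z. lin m (stereo (stereo_inv_inf z), 0)) 0" for m
      unfolding simple_pole_def
    proof (intro exI conjI)
      show "\<forall>\<^sub>F z in at 0. lin m (stereo (stereo_inv_inf z), 0) * z = 1"
        by (auto simp: eventually_at lin_def stereo_stereo_inv_inf intro!: exI[of _ 1])
    qed (auto intro!: analytic_intros)
  qed
  ultimately show ?thesis
    by (auto simp: punctured_embedding_def norm_prod_def)
qed

text \<open>The last clause holds at every point: where the shear is not small, the invariant form
  \<open>lin n\<close> is large.\<close>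

definition shear_step ::
  "nat \<Rightarrow> (rs_point \<Rightarrow> complex \<times> complex) \<Rightarrow> rs_point set \<Rightarrow> real \<Rightarrow>
   (rs_point \<Rightarrow> rs_point) \<Rightarrow> (rs_point \<Rightarrow> complex \<times> complex) \<Rightarrow> bool" where
  "shear_step n G P r q G' \<longleftrightarrow>
     (\<forall>p\<in>P. q p \<in> riemann_sphere \<inter> ball p r \<and> q p \<notin> P) \<and>
     (\<forall>x \<in> riemann_sphere - (\<Union>p\<in>P. ball p r). dist (G' x) (G x) \<le> (1/2) ^ Suc n) \<and>
     (\<forall>x \<in> riemann_sphere - (\<Union>p\<in>P. ball p r). \<forall>y \<in> riemann_sphere - (\<Union>p\<in>P. ball p r).
        (1 - (1/2) ^ (n + 2)) * dist (G x) (G y) \<le> dist (G' x) (G' y)) \<and>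
     (\<forall>x. min (norm (G x)) (real n + 2) - (1/2) ^ Suc n \<le> norm (G' x))"

text \<open>Here \<open>q p\<close> is the point in the disc about \<open>p\<close> where the curve
  meets the line \<open>lin n = a\<close>: it exists because of the pole at \<open>p\<close>, and it
  is unique because \<open>lin n\<close> is injective there.\<close>

lemma shear_step_exists:
  assumes emb: "punctured_embedding n G P" and rad: "good_radius n G P r"
  obtains q G' where "shear_step n G P r q G'" "punctured_embedding (Suc n) G' (P \<union> q ` P)"
proof -
  have P: "finite P" "card P \<le> 2 ^ n" "P \<subseteq> riemann_sphere"
    and hol: "hol_pair G (riemann_sphere - P)" and inj: "inj_on G (riemann_sphere - P)"
    and imm: "immersive G (riemann_sphere - P)" and poles: "\<And>p. p \<in> P \<Longrightarrow> has_poles n G p"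
    using emb by (auto simp: punctured_embedding_def)
  have r: "0 < r" "\<And>p p'. p \<in> P \<Longrightarrow> p' \<in> P \<Longrightarrow> p \<noteq> p' \<Longrightarrow> 2 * r < dist p p'"
    and rinj: "\<And>p. p \<in> P \<Longrightarrow> inj_on (\<lambda>x. lin n (G x)) (riemann_sphere \<inter> cball p r - {p})"
    using rad by (auto simp: good_radius_def)
  define K where "K = riemann_sphere - (\<Union>p\<in>P. ball p r)"
  have KP: "K \<subseteq> riemann_sphere - P" using r(1) by (auto simp: K_def)
  have "compact K" unfolding K_def by (intro compact_diff compact_sphere open_UN) auto
  moreover have "continuous_on K G"
    using hol_pair_continuous_on[OF hol] finite_imp_closed[OF P(1)] KP continuous_on_subset by blast
  ultimately have "bounded (G ` K)" by (intro compact_imp_bounded compact_continuous_image)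
  then obtain M where M: "0 < M" "\<And>x. x \<in> K \<Longrightarrow> norm (G x) \<le> M" unfolding bounded_pos by auto
  have "\<forall>\<^sub>F t in at_top. \<exists>x \<in> riemann_sphere \<inter> ball p r - {p}. lin n (G x) = complex_of_real t" if p: "p \<in> P" for p
  proof -
    obtain c \<zeta> where c: "c \<in> charts" "c \<zeta> = p" "simple_pole (\<lambda>z. lin n (G (c z))) \<zeta>"
      using poles[OF p] unfolding has_poles_def by blast
    show ?thesis using chart_pole_surj[OF c(1), of "\<lambda>x. lin n (G x)" \<zeta> r, OF c(3) r(1)] unfolding c(2) .
  qed
  then have "\<forall>\<^sub>F t in at_top. \<forall>p\<in>P. \<exists>x \<in> riemann_sphere \<inter> ball p r - {p}. lin n (G x) = complex_of_real t"
    by (intro eventually_ball_finite P(1)) auto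
  \<comment> \<open>\<open>2 * M + 1\<close> keeps \<open>lin n\<close> at distance 1 from
    \<open>a\<close> over \<open>K\<close>; \<open>2 * (real n + 2) + 1\<close> is the hypothesis of
    \<open>norm_shear_ge\<close> with \<open>R = n + 2\<close>.\<close>
  moreover have "\<forall>\<^sub>F t in at_top. 2 * M + 2 * (real n + 2) + 1 \<le> (t :: real)" by (rule eventually_ge_at_top)
  ultimately have "\<forall>\<^sub>F t in at_top. (\<forall>p\<in>P. \<exists>x \<in> riemann_sphere \<inter> ball p r - {p}. lin n (G x) = complex_of_real t)
      \<and> 2 * M + 2 * (real n + 2) + 1 \<le> t"
    by (rule eventually_conj)
  then obtain t where t: "\<forall>p\<in>P. \<exists>x \<in> riemann_sphere \<inter> ball p r - {p}. lin n (G x) = complex_of_real t"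
      "2 * M + 2 * (real n + 2) + 1 \<le> t"
    using eventually_happens' trivial_limit_at_top_linorder by blast
  define a where "a = complex_of_real t"
  have a: "2 * M + 1 \<le> cmod a" "2 * (real n + 2) + 1 \<le> cmod a" using t(2) M(1) by (auto simp: a_def)
  obtain q where q: "\<And>p. p \<in> P \<Longrightarrow> q p \<in> riemann_sphere \<inter> ball p r - {p}" "\<And>p. p \<in> P \<Longrightarrow> lin n (G (q p)) = a"
    using t(1) unfolding a_def by metis
  \<comment> \<open>The point \<open>q p\<close> is closer than \<open>r\<close> to
    \<open>p\<close>, and other punctures are more than \<open>2 * r\<close> away.\<close>
  have qP: "q p \<notin> P" if "p \<in> P" for p
    using q(1)[OF that] r(2)[of p "q p"] that r(1) by (auto simp: dist_commute)
  have far: "1 \<le> cmod (lin n (G x) - a)" if "x \<in> K" for x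
  proof -
    have "cmod (lin n (G x)) \<le> 2 * M" using cmod_lin_le[of n "G x"] M(2)[OF that] by linarith
    then show ?thesis using norm_triangle_sub[of a "lin n (G x)"] a(1) by (simp add: norm_minus_commute)
  qed
  \<comment> \<open>The shear is regular off the old and new punctures: over \<open>K\<close> the
    form stays away from \<open>a\<close>, and in a disc injectivity leaves only
    \<open>q p\<close>.\<close>
  have fibre: "lin n (G x) \<noteq> a" if x: "x \<in> riemann_sphere - (P \<union> q ` P)" for x
  proof (cases "x \<in> K")
    case True
    then show ?thesis using far[of x] by auto
  next
    case False
    then obtain p where p: "p \<in> P" "x \<in> ball p r" using x False unfolding K_def by blast
    show ?thesis
    proof
      assume "lin n (G x) = a"
      then have "x = q p"
        using inj_onD[OF rinj[OF p(1)], of x "q p"] q[OF p(1)] x p by auto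
      then show False using x p by auto
    qed
  qed
  \<comment> \<open>Chosen so that \<open>4 * cmod e = (1/2) ^ (n + 2)\<close>, the Lipschitz loss
    allowed by \<open>shear_step\<close>; the displacement \<open>2 * cmod e\<close> is then below
    \<open>(1/2) ^ Suc n\<close>.\<close>
  define e :: complex where "e = (1/2) ^ (n + 4)"
  have e: "e \<noteq> 0" "cmod e = (1/2) ^ (n + 4)" by (auto simp: e_def norm_power norm_divide)
  define G' where "G' = (\<lambda>x. shear n a e (G x))"
  have "shear_step n G P r q G'"
    unfolding shear_step_def K_def[symmetric]
  proof (intro conjI ballI allI)
    show "q p \<in> riemann_sphere \<inter> ball p r" "q p \<notin> P" if "p \<in> P" for p using q(1) qP that by auto
    show "dist (G' x) (G x) \<le> (1/2) ^ Suc n" if "x \<in> K" for x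
    proof -
      have "2 * (1/2 :: real) ^ (n + 4) \<le> (1/2) ^ Suc n" by (simp add: power_add power4_eq_xxxx)
      then show ?thesis using dist_shear_le[OF far[OF that], of e] e(2) unfolding G'_def by linarith
    qed
    show "(1 - (1/2) ^ (n + 2)) * dist (G x) (G y) \<le> dist (G' x) (G' y)" if "x \<in> K" "y \<in> K" for x y
      using dist_shear_ge[OF far[OF that(1)] far[OF that(2)], of e] unfolding G'_def e(2)
      by (simp add: power_add power4_eq_xxxx power2_eq_square)
    show "min (norm (G x)) (real n + 2) - (1/2) ^ Suc n \<le> norm (G' x)" for x
    proof -
      have "2 * (1/2 :: real) ^ (n + 4) \<le> (1/2) ^ Suc n" by (simp add: power_add power4_eq_xxxx)
      then show ?thesis using norm_shear_ge[OF a(2), of "G x" e n] unfolding G'_def e(2) by linarith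
    qed
  qed
  moreover have "punctured_embedding (Suc n) G' (P \<union> q ` P)"
    unfolding punctured_embedding_def
  proof (intro conjI ballI)
    show "finite (P \<union> q ` P)" using P(1) by simp
    have "card (P \<union> q ` P) \<le> card P + card P"
      using card_Un_le[of P "q ` P"] card_image_le[OF P(1), of q] by linarith
    then show "card (P \<union> q ` P) \<le> 2 ^ Suc n" using P(2) by simp
    show "P \<union> q ` P \<subseteq> riemann_sphere" using P(3) q(1) by auto
    have cl: "closed (P \<union> q ` P)" using P(1) by (intro finite_imp_closed) auto
    have hol': "hol_pair G (riemann_sphere - (P \<union> q ` P))" by (rule hol_pair_subset[OF hol]) auto
    show "hol_pair G' (riemann_sphere - (P \<union> q ` P))"
      unfolding G'_def by (rule hol_pair_shear[OF hol' fibre])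
    have "immersive G (riemann_sphere - (P \<union> q ` P))"
      using imm unfolding immersive_def by blast
    then show "immersive G' (riemann_sphere - (P \<union> q ` P))"
      unfolding G'_def by (intro immersive_shear hol' cl fibre)
    show "inj_on G' (riemann_sphere - (P \<union> q ` P))"
      unfolding G'_def using inj by (auto simp: inj_on_def dest!: shear_inj)
    fix p assume "p \<in> P \<union> q ` P"
    then consider "p \<in> P" | p' where "p' \<in> P" "p = q p'" by blast
    then show "has_poles (Suc n) G' p"
    proof cases
      case 1
      then obtain c \<zeta> where c: "c \<in> charts" "c \<zeta> = p" "\<And>m. m \<ge> n \<Longrightarrow> simple_pole (\<lambda>z. lin m (G (c z))) \<zeta>"
        using poles unfolding has_poles_def by blast
      have "simple_pole (\<lambda>z. lin m (G' (c z))) \<zeta>" if "m \<ge> Suc n" for m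
        unfolding G'_def lin_shear using that by (intro simple_pole_add c(3)) auto
      then show ?thesis unfolding has_poles_def using c(1,2) by blast
    next
      case 2
      obtain c \<zeta> where c: "c \<in> charts" "c \<zeta> = p"
        using chart_cover[of p] q(1)[OF 2(1)] 2(2) by blast
      have cl: "closed P" using P(1) by (rule finite_imp_closed)
      define W where "W = c -` (riemann_sphere - P) \<inter> c -` ball p' r"
      have "open (c -` ball p' r)"
        using continuous_on_chart[OF c(1), of UNIV] by (simp add: continuous_on_open_vimage)
      then have W: "open W" "\<zeta> \<in> W" "W \<subseteq> c -` (riemann_sphere - P)"
        using open_chart_vimage[OF c(1) cl] q(1)[OF 2(1)] qP[OF 2(1)] 2(2) c(2) by (auto simp: W_def)
      have holl: "(\<lambda>z. lin m (G (c z))) holomorphic_on W" for m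
        using hol_pair_lin[OF hol c(1)] W(3) by (rule holomorphic_on_subset)
      then have an: "(\<lambda>z. lin m (G (c z))) analytic_on {\<zeta>}" for m
        using W analytic_at by blast
      have "inj_on (\<lambda>z. lin n (G (c z))) W"
      proof (rule inj_onI)
        fix u v assume uv: "u \<in> W" "v \<in> W" "lin n (G (c u)) = lin n (G (c v))"
        then have "c u = c v"
          using 2(1) by (intro inj_onD[OF rinj[OF 2(1)]]) (auto simp: W_def)
        then show "u = v" using inj_chart[OF c(1)] by (auto dest: injD)
      qed
      \<comment> \<open>Injectivity of \<open>lin n\<close> makes the zero of
        \<open>lin n \<circ> G - a\<close> at the new puncture simple, as
        \<open>simple_pole_new\<close> requires.\<close>
      then have d: "deriv (\<lambda>z. lin n (G (c z))) \<zeta> \<noteq> 0"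
        using holomorphic_injective_imp_regular[OF holl W(1)] W(2) by blast
      have val: "lin n (G (c \<zeta>)) = a" using q(2)[OF 2(1)] 2(2) c(2) by simp
      have "simple_pole (\<lambda>z. lin m (G' (c z))) \<zeta>" if "m \<ge> Suc n" for m
      proof -
        have "(slope n - slope m) * e \<noteq> 0" using that e(1) by simp
        then show ?thesis
          using simple_pole_new[OF an[of m] an[of n] d] unfolding G'_def lin_shear val by blast
      qed
      then show ?thesis unfolding has_poles_def using c by blast
    qed
  qed
  ultimately show ?thesis by (rule that)
qed

section \<open>The limit embedding\<close>

text \<open>A convergent sequence together with its limit is compact; by properness so is its
  preimage, and a continuous injection on a compact set has a continuous inverse.\<close>

lemma proper_injective_imp_homeomorphism:
  fixes g :: "'a::metric_space \<Rightarrow> 'b::heine_borel"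
  assumes proper: "proper_map_on g U" and cont: "continuous_on U g" and inj: "inj_on g U"
  shows "\<exists>h. homeomorphism U (g ` U) g h"
proof -
  define h where "h = the_inv_into U g"
  have hg: "h (g x) = x" if "x \<in> U" for x
    using the_inv_into_f_f[OF inj that] by (simp add: h_def)
  have "continuous_on (g ` U) h"
    unfolding continuous_on_sequentially
  proof (intro allI ballI impI, elim conjE)
    fix x a assume a: "a \<in> g ` U" and x: "\<forall>n. x n \<in> g ` U" and lim: "x \<longlonglongrightarrow> a"
    define L where "L = insert a (range x)"
    define S where "S = {y \<in> U. g y \<in> L}"
    have "compact L" unfolding L_def by (rule compact_sequence_with_limit[OF lim])
    then have "compact S" using proper unfolding S_def proper_map_on_def by blast
    moreover have "S \<subseteq> U" by (auto simp: S_def)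
    ultimately obtain k where k: "homeomorphism S (g ` S) g k"
      using homeomorphism_compact[OF _ continuous_on_subset[OF cont] refl inj_on_subset[OF inj]] by blast
    have "L \<subseteq> g ` U" using a x by (auto simp: L_def)
    then have "L = g ` S" unfolding S_def by blast
    have "continuous_on L k" using homeomorphism_cont2[OF k] \<open>L = g ` S\<close> by simp
    then have "(k \<circ> x) \<longlonglongrightarrow> k a"
      unfolding continuous_on_sequentially using lim by (simp add: L_def)
    moreover have "k y = h y" if "y \<in> L" for y
      using that \<open>L = g ` S\<close> homeomorphism_apply1[OF k] hg \<open>S \<subseteq> U\<close> by auto
    ultimately show "(h \<circ> x) \<longlonglongrightarrow> h a" by (simp add: L_def o_def)
  qed
  then have "homeomorphism U (g ` U) g h"
    using cont hg by (intro homeomorphismI) auto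
  then show ?thesis by blast
qed

text \<open>The difference quotients of \<open>h\<close> are squeezed by those of \<open>f1\<close>
  and \<open>f2\<close>. This carries a zero of the differential from the limit map back to a finite
  stage.\<close>

lemma has_field_derivative_0_dominated:
  fixes f1 f2 h :: "complex \<Rightarrow> complex"
  assumes "(f1 has_field_derivative 0) (at z)" "(f2 has_field_derivative 0) (at z)"
    and dom: "\<forall>\<^sub>F w in at z. cmod (h w - h z) \<le> B * (cmod (f1 w - f1 z) + cmod (f2 w - f2 z))"
  shows "(h has_field_derivative 0) (at z)"
  unfolding has_field_derivative_iff
proof (rule Lim_null_comparison)
  have "((\<lambda>w. (f1 w - f1 z) / (w - z)) \<longlongrightarrow> 0) (at z)" "((\<lambda>w. (f2 w - f2 z) / (w - z)) \<longlongrightarrow> 0) (at z)"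
    using assms(1,2) unfolding has_field_derivative_iff by auto
  then have "((\<lambda>w. B * (cmod ((f1 w - f1 z) / (w - z)) + cmod ((f2 w - f2 z) / (w - z)))) \<longlongrightarrow> B * (cmod 0 + cmod 0)) (at z)"
    by (intro tendsto_intros)
  then show "((\<lambda>w. B * (cmod ((f1 w - f1 z) / (w - z)) + cmod ((f2 w - f2 z) / (w - z)))) \<longlongrightarrow> 0) (at z)"
    by simp
  show "\<forall>\<^sub>F w in at z. cmod ((h w - h z) / (w - z))
      \<le> B * (cmod ((f1 w - f1 z) / (w - z)) + cmod ((f2 w - f2 z) / (w - z)))"
    using dom
  proof eventually_elim
    case (elim w)
    have "cmod (h w - h z) / cmod (w - z) \<le> (B * (cmod (f1 w - f1 z) + cmod (f2 w - f2 z))) / cmod (w - z)"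
      by (rule divide_right_mono[OF elim]) simp
    then show ?case by (simp add: norm_divide add_divide_distrib distrib_left)
  qed
qed

text \<open>The two clauses of \<open>nest\<close> put both children of a disc inside the open
  parent disc, so the discs form a binary tree.\<close>

locale shear_sequence =
  fixes G :: "nat \<Rightarrow> rs_point \<Rightarrow> complex \<times> complex" and P :: "nat \<Rightarrow> rs_point set"
    and r :: "nat \<Rightarrow> real" and q :: "nat \<Rightarrow> rs_point \<Rightarrow> rs_point"
  assumes emb: "punctured_embedding n (G n) (P n)"
    and rad: "good_radius n (G n) (P n) (r n)"
    and step: "shear_step n (G n) (P n) (r n) (q n) (G (Suc n))"
    and P_0: "P 0 = {(1, 0)}"
    and P_Suc: "P (Suc n) = P n \<union> q n ` P n"
    and nest: "p \<in> P n \<Longrightarrow> cball p (r (Suc n)) \<subseteq> ball p (r n)"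
      "p \<in> P n \<Longrightarrow> cball (q n p) (r (Suc n)) \<subseteq> ball p (r n)"
begin

definition D :: "nat \<Rightarrow> rs_point set" where "D n = (\<Union>p\<in>P n. cball p (r n))"
text \<open>Open discs are removed here, while \<open>D\<close> uses closed ones: \<open>K n\<close>
  becomes compact and \<open>D n\<close> closed. Strict nesting takes care of the boundary
  circles.\<close>

definition K :: "nat \<Rightarrow> rs_point set" where "K n = riemann_sphere - (\<Union>p\<in>P n. ball p (r n))"
definition C :: "rs_point set" where "C = riemann_sphere \<inter> (\<Inter>n. D n)"
text \<open>Meaningful off \<open>C\<close>: such a point lies in some \<open>K n\<close>, and from
  stage \<open>n\<close> on the sequence is Cauchy there.\<close>

definition F :: "rs_point \<Rightarrow> complex \<times> complex" where "F x = lim (\<lambda>n. G n x)"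

lemma P_finite: "finite (P n)" and P_card: "card (P n) \<le> 2 ^ n" and P_sphere: "P n \<subseteq> riemann_sphere"
  and G_hol: "hol_pair (G n) (riemann_sphere - P n)" and G_inj: "inj_on (G n) (riemann_sphere - P n)"
  and G_imm: "immersive (G n) (riemann_sphere - P n)"
  using emb[of n] unfolding punctured_embedding_def by blast+

lemma r_pos: "0 < r n" and r_small: "6 * r n \<le> (1/2) ^ (n * n)"
  and r_disjoint: "\<And>p p'. p \<in> P n \<Longrightarrow> p' \<in> P n \<Longrightarrow> p \<noteq> p' \<Longrightarrow> 2 * r n < dist p p'"
  and G_large: "\<And>p x. p \<in> P n \<Longrightarrow> x \<in> riemann_sphere \<inter> cball p (r n) - {p} \<Longrightarrow> real n + 1 \<le> norm (G n x)"
  using rad[of n] unfolding good_radius_def by blast+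

lemma cball_disjoint:
  assumes "p \<in> P n" "p' \<in> P n" "x \<in> cball p (r n)" "x \<in> cball p' (r n)"
  shows "p = p'"
proof (rule ccontr)
  assume "p \<noteq> p'"
  then have "2 * r n < dist p p'" using r_disjoint assms by blast
  then show False using dist_triangle2[of p p' x] assms(3,4) by simp
qed

lemma P_mono: "m \<le> n \<Longrightarrow> P m \<subseteq> P n"
  by (rule lift_Suc_mono_le[of P]) (auto simp: P_Suc)

lemma D_Suc_subset: "D (Suc n) \<subseteq> (\<Union>p\<in>P n. ball p (r n))"
proof
  fix x assume "x \<in> D (Suc n)"
  then obtain p where p: "p \<in> P n" "x \<in> cball p (r (Suc n)) \<or> x \<in> cball (q n p) (r (Suc n))"
    unfolding D_def P_Suc by blast
  have "x \<in> ball p (r n)" using nest[OF p(1)] p(2) by blast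
  with p(1) show "x \<in> (\<Union>p\<in>P n. ball p (r n))" by blast
qed

lemma D_antimono: "m \<le> n \<Longrightarrow> D n \<subseteq> D m"
proof (rule lift_Suc_antimono_le[of D])
  fix n
  have "(\<Union>p\<in>P n. ball p (r n)) \<subseteq> D n" unfolding D_def using ball_subset_cball by blast
  then show "D (Suc n) \<subseteq> D n" using D_Suc_subset by blast
qed

lemma closed_D: "closed (D n)"
  unfolding D_def using P_finite by (intro closed_UN) auto

lemma closed_C: "closed C"
  unfolding C_def using closed_D by (intro closed_Int closed_INT) auto

lemma compact_C: "compact C"
  unfolding C_def by (intro compact_Int_closed compact_sphere closed_INT ballI closed_D)

lemma P_subset_C: "P n \<subseteq> C"
proof
  fix p assume p: "p \<in> P n"
  have "p \<in> D m" for m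
  proof -
    have "p \<in> P (max m n)" using P_mono[of n "max m n"] p by auto
    then have "p \<in> D (max m n)" using r_pos[of "max m n"] unfolding D_def by force
    then show ?thesis using D_antimono[of m "max m n"] by auto
  qed
  then show "p \<in> C" using p P_sphere unfolding C_def by blast
qed

lemma outside_D_subset_K: "riemann_sphere - D n \<subseteq> K n"
  unfolding K_def D_def using ball_subset_cball by blast

lemma K_Suc: "K n \<subseteq> K (Suc n)"
  using D_Suc_subset[of n] outside_D_subset_K[of "Suc n"] unfolding K_def by blast

lemma K_mono: "m \<le> n \<Longrightarrow> K m \<subseteq> K n"
  by (rule lift_Suc_mono_le[of K]) (rule K_Suc)

lemma K_subset: "K n \<subseteq> riemann_sphere - C"
  using D_Suc_subset[of n] unfolding K_def C_def by blast

lemma compact_K: "compact (K n)"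
  unfolding K_def by (intro compact_diff compact_sphere open_UN) auto

lemma outside_C:
  assumes "x \<in> riemann_sphere - C"
  obtains n where "x \<in> riemann_sphere - D n"
  using assms unfolding C_def by blast

text \<open>The bound is a difference so that the induction on \<open>k\<close> telescopes, one step
  costing \<open>(1/2) ^ k - (1/2) ^ Suc k\<close>.\<close>

lemma G_Cauchy:
  assumes "x \<in> K n" "n \<le> m" "m \<le> k"
  shows "dist (G k x) (G m x) \<le> (1/2) ^ m - (1/2) ^ k"
  using assms(3)
proof (induction k rule: dec_induct)
  case (step k)
  have "x \<in> K k" using assms(1,2) step K_mono[of n k] by auto
  then have "dist (G (Suc k) x) (G k x) \<le> (1/2) ^ Suc k"
    using shear_sequence.step[OF shear_sequence_axioms, of k] unfolding shear_step_def K_def by blast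
  with step.IH dist_triangle[of "G (Suc k) x" "G m x" "G k x"] show ?case by simp
qed simp

lemma G_Cauchy': "x \<in> K n \<Longrightarrow> n \<le> m \<Longrightarrow> m \<le> k \<Longrightarrow> dist (G k x) (G m x) \<le> (1/2) ^ m"
  using G_Cauchy[of x n m k] zero_le_power[of "1/2 :: real" k] by linarith

lemma half_power_less: "0 < e \<Longrightarrow> \<exists>N. (1/2) ^ N < (e :: real)"
  using real_arch_pow_inv[of e "1/2"] by auto

lemma G_tendsto_F:
  assumes "x \<in> K n"
  shows "(\<lambda>m. G m x) \<longlonglongrightarrow> F x"
proof -
  have "Cauchy (\<lambda>m. G m x)"
  proof (rule metric_CauchyI)
    fix e :: real assume "0 < e"
    then obtain N where N: "(1/2) ^ N < e / 2" using half_power_less[of "e/2"] by auto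
    have "dist (G m x) (G (max n N) x) < e / 2" if "m \<ge> max n N" for m
    proof -
      have "(1/2 :: real) ^ max n N \<le> (1/2) ^ N" by (intro power_decreasing) auto
      then show ?thesis using G_Cauchy'[OF assms, of "max n N" m] that N by linarith
    qed
    then show "\<exists>M. \<forall>m\<ge>M. \<forall>k\<ge>M. dist (G m x) (G k x) < e"
      by (meson dist_triangle_half_l)
  qed
  then show ?thesis unfolding F_def by (simp add: Cauchy_convergent_iff convergent_LIMSEQ_iff)
qed

lemma F_approx:
  assumes "x \<in> K n" "n \<le> m"
  shows "dist (F x) (G m x) \<le> (1/2) ^ m"
proof (rule tendsto_upperbound)
  show "(\<lambda>k. dist (G k x) (G m x)) \<longlonglongrightarrow> dist (F x) (G m x)"
    by (intro tendsto_dist G_tendsto_F[OF assms(1)] tendsto_const)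
  show "\<forall>\<^sub>F k in sequentially. dist (G k x) (G m x) \<le> (1/2) ^ m"
    using G_Cauchy'[OF assms] by (auto simp: eventually_sequentially)
qed simp

text \<open>The lower Lipschitz constants \<open>1 - 2\<^bsup>-m-2\<^esup>\<close> of the steps dominate the telescoping
  quotients of \<open>1 + 2\<^bsup>-m\<^esup>\<close>.\<close>

lemma dist_F_ge:
  assumes "x \<in> K n" "y \<in> K n"
  shows "dist (G n x) (G n y) \<le> 2 * dist (F x) (F y)"
proof -
  have bound: "(1 + (1/2) ^ m) * dist (G n x) (G n y) \<le> 2 * dist (G m x) (G m y)" if "n \<le> m" for m
    using that
  proof (induction m rule: dec_induct)
    case base
    have "1 + (1/2 :: real) ^ n \<le> 2" using power_le_one[of "1/2 :: real" n] by simp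
    then show ?case by (intro mult_right_mono) auto
  next
    case (step m)
    define u where "u = (1/2 :: real) ^ m"
    have u: "0 \<le> u" "u \<le> 1" by (auto simp: u_def power_le_one)
    have "x \<in> K m" "y \<in> K m" using assms step K_mono[of n m] by auto
    then have "(1 - (1/2) ^ (m + 2)) * dist (G m x) (G m y) \<le> dist (G (Suc m) x) (G (Suc m) y)"
      using shear_sequence.step[OF shear_sequence_axioms, of m] unfolding shear_step_def K_def by blast
    then have *: "(1 - u / 4) * (2 * dist (G m x) (G m y)) \<le> 2 * dist (G (Suc m) x) (G (Suc m) y)"
      by (simp add: u_def power_add power2_eq_square)
    have "u * u \<le> u * 1" using u by (intro mult_left_mono) auto
    moreover have "(1 - u / 4) * (1 + u) = 1 + 3 / 4 * u - u * u / 4" by (simp add: field_simps)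
    ultimately have "1 + u / 2 \<le> (1 - u / 4) * (1 + u)" using u by simp
    then have "(1 + u / 2) * dist (G n x) (G n y) \<le> (1 - u / 4) * (1 + u) * dist (G n x) (G n y)"
      by (rule mult_right_mono) simp
    also have "\<dots> \<le> (1 - u / 4) * (2 * dist (G m x) (G m y))"
      unfolding mult.assoc using step.IH u unfolding u_def[symmetric] by (intro mult_left_mono) auto
    finally show ?case using * by (simp add: u_def)
  qed
  show ?thesis
  proof (rule tendsto_lowerbound)
    show "(\<lambda>m. 2 * dist (G m x) (G m y)) \<longlonglongrightarrow> 2 * dist (F x) (F y)"
      by (intro tendsto_mult tendsto_dist G_tendsto_F[OF assms(1)] G_tendsto_F[OF assms(2)] tendsto_const)
    have "dist (G n x) (G n y) \<le> 2 * dist (G m x) (G m y)" if "n \<le> m" for m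
    proof -
      have "1 * dist (G n x) (G n y) \<le> (1 + (1/2) ^ m) * dist (G n x) (G n y)"
        by (intro mult_right_mono) auto
      then show ?thesis using bound[OF that] by simp
    qed
    then show "\<forall>\<^sub>F m in sequentially. dist (G n x) (G n y) \<le> 2 * dist (G m x) (G m y)"
      by (auto simp: eventually_sequentially)
  qed simp
qed

text \<open>The slack \<open>(1/2) ^ m\<close> is at first covered by the surplus 1 of
  \<open>good_radius\<close>, and each step spends half of what is left. The cap
  \<open>real m + 2\<close> of a step does no harm as \<open>n \<le> m\<close>. Whether
  \<open>x\<close> stays in the later discs is immaterial.\<close>

lemma norm_F_ge:
  assumes x: "x \<in> riemann_sphere - C" and "x \<notin> K n"
  shows "real n \<le> norm (F x)"
proof -
  have bound: "real n + (1/2) ^ m \<le> norm (G m x)" if "n \<le> m" for m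
    using that
  proof (induction m rule: dec_induct)
    case base
    obtain p where p: "p \<in> P n" "x \<in> ball p (r n)" using assms unfolding K_def by blast
    then have "x \<noteq> p" using P_subset_C[of n] x by blast
    then have "real n + 1 \<le> norm (G n x)" using G_large[OF p(1), of x] p(2) x by auto
    then show ?case using power_le_one[of "1/2 :: real" n] by simp
  next
    case (step m)
    have *: "min (norm (G m x)) (real m + 2) - (1/2) ^ Suc m \<le> norm (G (Suc m) x)"
      using shear_sequence.step[OF shear_sequence_axioms, of m] unfolding shear_step_def by blast
    have "real n + (1/2) ^ m \<le> real m + 2"
      using step(1) power_le_one[of "1/2 :: real" m] by simp
    with step.IH have "real n + (1/2) ^ m \<le> min (norm (G m x)) (real m + 2)" by simp
    moreover have "(1/2 :: real) ^ m - (1/2) ^ Suc m = (1/2) ^ Suc m" by simp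
    ultimately show ?case using * by linarith
  qed
  obtain k where "x \<in> riemann_sphere - D k" using outside_C[OF x] .
  then have "x \<in> K k" using outside_D_subset_K by blast
  show ?thesis
  proof (rule tendsto_lowerbound)
    show "(\<lambda>m. norm (G m x)) \<longlonglongrightarrow> norm (F x)" by (rule tendsto_norm[OF G_tendsto_F[OF \<open>x \<in> K k\<close>]])
    have "real n \<le> norm (G m x)" if "n \<le> m" for m
      using bound[OF that] zero_le_power[of "1/2 :: real" m] by linarith
    then show "\<forall>\<^sub>F m in sequentially. real n \<le> norm (G m x)" by (auto simp: eventually_sequentially)
  qed simp
qed

lemma G_hol_U: "hol_pair (G n) (riemann_sphere - C)"
  by (rule hol_pair_subset[OF G_hol]) (use P_subset_C in blast)

text \<open>Turns estimates over a single \<open>K n\<close> into locally uniform ones in a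
  chart.\<close>

lemma chart_outside_C:
  assumes "c \<in> charts" "z \<in> c -` (riemann_sphere - C)"
  obtains n d where "d > 0" "c ` cball z d \<subseteq> K n" "cball z d \<subseteq> c -` (riemann_sphere - C)"
proof -
  obtain n where n: "c z \<in> riemann_sphere - D n" using outside_C assms(2) by blast
  then have "open (c -` (riemann_sphere - D n))" "z \<in> c -` (riemann_sphere - D n)"
    using open_chart_vimage[OF assms(1) closed_D] by auto
  then obtain d where d: "d > 0" "cball z d \<subseteq> c -` (riemann_sphere - D n)" by (meson open_contains_cball)
  then have "c ` cball z d \<subseteq> K n" using outside_D_subset_K by blast
  moreover from this have "cball z d \<subseteq> c -` (riemann_sphere - C)" using K_subset[of n] by blast
  ultimately show ?thesis using that d(1) by blast
qed

lemma F_hol: "hol_pair F (riemann_sphere - C)"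
proof -
  \<comment> \<open>\<open>pr\<close> stands for \<open>fst\<close> and for \<open>snd\<close>, both
    1-Lipschitz.\<close>
  have unif: "\<exists>d>0. cball z d \<subseteq> c -` (riemann_sphere - C) \<and>
      uniform_limit (cball z d) (\<lambda>n z. pr (G n (c z))) (\<lambda>z. pr (F (c z))) sequentially"
    if c: "c \<in> charts" "z \<in> c -` (riemann_sphere - C)"
      and pr: "\<And>u v. dist (pr u) (pr v) \<le> dist u v" for c z and pr :: "complex \<times> complex \<Rightarrow> complex"
  proof -
    obtain n d where d: "d > 0" "c ` cball z d \<subseteq> K n" "cball z d \<subseteq> c -` (riemann_sphere - C)"
      using chart_outside_C[OF c] .
    have "uniform_limit (cball z d) (\<lambda>n z. pr (G n (c z))) (\<lambda>z. pr (F (c z))) sequentially"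
    proof (rule uniform_limitI)
      fix e :: real assume "0 < e"
      then obtain N where N: "(1/2) ^ N < e" using half_power_less by blast
      have "dist (pr (G m (c w))) (pr (F (c w))) < e" if "m \<ge> max n N" "w \<in> cball z d" for m w
      proof -
        have "c w \<in> K n" using d(2) that(2) by blast
        then have "dist (G m (c w)) (F (c w)) \<le> (1/2) ^ m"
          using F_approx[of "c w" n m] that(1) by (simp add: dist_commute)
        also have "\<dots> \<le> (1/2) ^ N" using that(1) by (intro power_decreasing) auto
        finally show ?thesis using pr[of "G m (c w)" "F (c w)"] N by linarith
      qed
      then show "\<forall>\<^sub>F m in sequentially. \<forall>w\<in>cball z d. dist (pr (G m (c w))) (pr (F (c w))) < e"
        unfolding eventually_sequentially by blast
    qed
    with d show ?thesis by blast
  qed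
  show ?thesis
    unfolding hol_pair_def
  proof (intro ballI conjI)
    fix c assume c: "c \<in> charts"
    have op: "open (c -` (riemann_sphere - C))" by (rule open_chart_vimage[OF c closed_C])
    show "(\<lambda>z. fst (F (c z))) holomorphic_on c -` (riemann_sphere - C)"
      by (rule holomorphic_uniform_sequence[OF op _ unif[OF c, of _ fst]])
        (use G_hol_U c in \<open>auto simp: hol_pair_def dist_fst_le\<close>)
    show "(\<lambda>z. snd (F (c z))) holomorphic_on c -` (riemann_sphere - C)"
      by (rule holomorphic_uniform_sequence[OF op _ unif[OF c, of _ snd]])
        (use G_hol_U c in \<open>auto simp: hol_pair_def dist_snd_le\<close>)
  qed
qed

text \<open>By \<open>dist_F_ge\<close> a coincidence of \<open>F\<close> would already be one of
  some \<open>G n\<close> with both points in \<open>K n\<close>.\<close>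

lemma F_inj: "inj_on F (riemann_sphere - C)"
proof (rule inj_onI)
  fix x y assume xy: "x \<in> riemann_sphere - C" "y \<in> riemann_sphere - C" "F x = F y"
  obtain m where "x \<in> riemann_sphere - D m" using outside_C[OF xy(1)] .
  moreover obtain k where "y \<in> riemann_sphere - D k" using outside_C[OF xy(2)] .
  ultimately have "x \<in> K (max m k)" "y \<in> K (max m k)"
    using outside_D_subset_K K_mono[of m "max m k"] K_mono[of k "max m k"] by (meson max.cobounded1 max.cobounded2 subsetD)+
  then have "G (max m k) x = G (max m k) y" using dist_F_ge[of x "max m k" y] xy(3) by simp
  then show "x = y" using G_inj[of "max m k"] xy P_subset_C[of "max m k"] by (auto dest!: inj_onD)
qed

text \<open>Convergence of derivatives could lose immersivity in the limit. Instead,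
  \<open>dist_F_ge\<close> bounds increments of some \<open>G n\<close> by those of
  \<open>F\<close>, so a vanishing derivative of \<open>F\<close> would contradict immersivity of
  \<open>G n\<close>.\<close>

lemma F_imm: "immersive F (riemann_sphere - C)"
  unfolding immersive_def
proof (intro ballI)
  fix c z assume c: "c \<in> charts" and z: "z \<in> c -` (riemann_sphere - C)"
  obtain n d where d: "d > 0" "c ` cball z d \<subseteq> K n" using chart_outside_C[OF c z] .
  have op: "open (c -` (riemann_sphere - C))" by (rule open_chart_vimage[OF c closed_C])
  have D: "((\<lambda>z. fst (F (c z))) has_field_derivative deriv (\<lambda>z. fst (F (c z))) z) (at z)"
    "((\<lambda>z. snd (F (c z))) has_field_derivative deriv (\<lambda>z. snd (F (c z))) z) (at z)"
    using F_hol c unfolding hol_pair_def by (auto intro!: holomorphic_derivI[OF _ op z])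
  have dom: "\<forall>\<^sub>F w in at z. dist (G n (c w)) (G n (c z))
      \<le> 2 * (cmod (fst (F (c w)) - fst (F (c z))) + cmod (snd (F (c w)) - snd (F (c z))))"
  proof -
    have "\<forall>\<^sub>F w in at z. w \<in> cball z d"
      using d(1) by (intro eventually_at_in_open'[THEN eventually_mono, of "ball z d"]) auto
    then show ?thesis
    proof eventually_elim
      case (elim w)
      then have "c w \<in> K n" "c z \<in> K n" using d by auto
      then have "dist (G n (c w)) (G n (c z)) \<le> 2 * dist (F (c w)) (F (c z))" by (rule dist_F_ge)
      also have "dist (F (c w)) (F (c z)) \<le> cmod (fst (F (c w)) - fst (F (c z))) + cmod (snd (F (c w)) - snd (F (c z)))"
        unfolding dist_prod_def dist_norm by (rule sqrt_sum_squares_le_sum) auto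
      finally show ?case by simp
    qed
  qed
  show "deriv (\<lambda>z. fst (F (c z))) z \<noteq> 0 \<or> deriv (\<lambda>z. snd (F (c z))) z \<noteq> 0"
  proof (rule ccontr)
    assume "\<not> ?thesis"
    then have D0: "((\<lambda>z. fst (F (c z))) has_field_derivative 0) (at z)"
      "((\<lambda>z. snd (F (c z))) has_field_derivative 0) (at z)" using D by auto
    have "((\<lambda>z. fst (G n (c z))) has_field_derivative 0) (at z)"
    proof (rule has_field_derivative_0_dominated[OF D0])
      show "\<forall>\<^sub>F w in at z. cmod (fst (G n (c w)) - fst (G n (c z)))
        \<le> 2 * (cmod (fst (F (c w)) - fst (F (c z))) + cmod (snd (F (c w)) - snd (F (c z))))"
        using dom
      proof eventually_elim
        case (elim w)
        then show ?case using dist_fst_le[of "G n (c w)" "G n (c z)"] unfolding dist_norm by linarith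
      qed
    qed
    moreover have "((\<lambda>z. snd (G n (c z))) has_field_derivative 0) (at z)"
    proof (rule has_field_derivative_0_dominated[OF D0])
      show "\<forall>\<^sub>F w in at z. cmod (snd (G n (c w)) - snd (G n (c z)))
        \<le> 2 * (cmod (fst (F (c w)) - fst (F (c z))) + cmod (snd (F (c w)) - snd (F (c z))))"
        using dom
      proof eventually_elim
        case (elim w)
        then show ?case using dist_snd_le[of "G n (c w)" "G n (c z)"] unfolding dist_norm by linarith
      qed
    qed
    ultimately have "deriv (\<lambda>z. fst (G n (c z))) z = 0" "deriv (\<lambda>z. snd (G n (c z))) z = 0"
      by (simp_all add: DERIV_imp_deriv)
    moreover have "z \<in> c -` (riemann_sphere - P n)" using z P_subset_C[of n] by blast
    ultimately show False using G_imm[of n] c unfolding immersive_def by blast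
  qed
qed

lemma F_continuous: "continuous_on (riemann_sphere - C) F"
  by (rule hol_pair_continuous_on[OF F_hol closed_C])

text \<open>A compact set is bounded, so by \<open>norm_F_ge\<close> its preimage lies in one
  compact \<open>K n\<close> and is closed in it.\<close>

lemma F_proper: "proper_map_on F (riemann_sphere - C)"
  unfolding proper_map_on_def
proof (intro allI impI)
  fix L :: "(complex \<times> complex) set" assume L: "compact L"
  obtain B where B: "\<And>y. y \<in> L \<Longrightarrow> norm y \<le> B" using compact_imp_bounded[OF L] unfolding bounded_iff by blast
  obtain n where n: "B < real n" using reals_Archimedean2 by blast
  have "x \<in> K n" if "x \<in> riemann_sphere - C" "F x \<in> L" for x
    using norm_F_ge[OF that(1), of n] B[OF that(2)] n by fastforce
  then have "{x \<in> riemann_sphere - C. F x \<in> L} = K n \<inter> F -` L" using K_subset[of n] by blast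
  moreover have "closed (K n \<inter> F -` L)"
    using continuous_on_subset[OF F_continuous K_subset] compact_imp_closed[OF compact_K] compact_imp_closed[OF L]
    by (rule continuous_closed_preimage)
  ultimately show "compact {x \<in> riemann_sphere - C. F x \<in> L}"
    using compact_K[of n] by (metis compact_Int_closed inf_left_idem)
qed

lemma F_embedding: "holomorphic_embedding F (riemann_sphere - C)"
proof -
  have "stereo_inv \<in> charts" "stereo_inv_inf \<in> charts" by (auto simp: charts_def)
  then show ?thesis
    using F_hol F_imm F_inj proper_injective_imp_homeomorphism[OF F_proper F_continuous F_inj]
    unfolding holomorphic_embedding_def sph_holomorphic_on_def sph_immersion_def hol_pair_def
      immersive_def o_def by blast
qed

section \<open>The limit set: dimension and Cantor structure\<close>

lemma C_dimension: "sph_hausdorff_dim C = 0"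
proof (rule sph_hausdorff_dim_eq_0)
  show "C \<subseteq> riemann_sphere" by (auto simp: C_def)
  have "C \<subseteq> (\<Union>p\<in>P n. cball p (r n))" for n unfolding C_def D_def by blast
  then show "\<exists>P r. finite P \<and> card P \<le> 2 ^ n \<and> 0 \<le> r \<and> 6 * r \<le> (1/2) ^ (n * n) \<and> C \<subseteq> (\<Union>p\<in>P. cball p r)" for n
    using P_finite P_card r_pos r_small by (meson less_imp_le)
qed

text \<open>The \<open>n\<close>-th digit of a point records whether, when its disc is split, it
  goes to the new puncture (\<open>B1 n\<close>) or stays with the old one (\<open>B0 n\<close>).
  Both sets are closed and they are disjoint, so the digit is continuous on
  \<open>C\<close>.\<close>

lemma C_cantor: "is_cantor_set C"
proof -
  define B1 where "B1 n = (\<Union>p\<in>P n. cball (q n p) (r (Suc n)))" for n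
  define B0 where "B0 n = (\<Union>p\<in>P n. cball p (r (Suc n)))" for n
  have D_Suc: "D (Suc n) = B0 n \<union> B1 n" for n by (auto simp: D_def B0_def B1_def P_Suc)
  have q_notin: "q n p \<notin> P n" if "p \<in> P n" for n p
    using step[of n] that unfolding shear_step_def by blast
  have disj: "x \<notin> B1 n" if x: "x \<in> B0 n" for x n
  proof
    assume "x \<in> B1 n"
    then obtain p where p: "p \<in> P n" "x \<in> cball (q n p) (r (Suc n))" unfolding B1_def by blast
    obtain p' where p': "p' \<in> P n" "x \<in> cball p' (r (Suc n))" using x unfolding B0_def by blast
    have "p' = q n p"
      by (rule cball_disjoint[of _ "Suc n", OF _ _ p'(2) p(2)]) (use p(1) p'(1) in \<open>auto simp: P_Suc\<close>)
    then show False using q_notin p(1) p'(1) by blast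
  qed
  have "middle_third_cantor homeomorphic C"
  proof (rule middle_third_homeomorphicI[of C "\<lambda>n x. x \<in> B1 n"])
    show "compact C" by (rule compact_C)
  next
    fix n
    have "closed (B0 n)" "closed (B1 n)" unfolding B0_def B1_def using P_finite by (auto intro!: closed_UN)
    then have "continuous_on (C \<inter> B1 n \<union> C \<inter> B0 n) (\<lambda>x. if x \<in> B1 n then 1 else 0 :: real)"
      using disj by (intro continuous_on_cases closed_Int closed_C continuous_on_const) auto
    moreover have "C \<inter> B1 n \<union> C \<inter> B0 n = C" using D_Suc[of n] unfolding C_def by blast
    ultimately show "continuous_on C (\<lambda>x. if x \<in> B1 n then 1 else 0 :: real)" by simp
  next
    fix x y assume xy: "x \<in> C" "y \<in> C" and eq: "\<And>n. (x \<in> B1 n) = (y \<in> B1 n)"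
    \<comment> \<open>Disjointness of the parent discs forces a point of the disc about
      \<open>p\<close> that lies in \<open>B0 n\<close> or \<open>B1 n\<close> into the
      corresponding child of that same disc.\<close>
    have common: "\<exists>p\<in>P n. x \<in> cball p (r n) \<and> y \<in> cball p (r n)" for n
    proof (induction n)
      case 0
      have "x \<in> D 0" "y \<in> D 0" using xy by (auto simp: C_def)
      then show ?case unfolding D_def P_0 by auto
    next
      case (Suc n)
      then obtain p where p: "p \<in> P n" "x \<in> cball p (r n)" "y \<in> cball p (r n)" by blast
      have in_D: "u \<in> B0 n \<union> B1 n" if "u \<in> C" for u using that D_Suc[of n] unfolding C_def by blast
      have near1: "u \<in> cball (q n p) (r (Suc n))" if u: "u \<in> B1 n" "u \<in> cball p (r n)" for u
      proof -
        obtain p' where p': "p' \<in> P n" "u \<in> cball (q n p') (r (Suc n))" using u unfolding B1_def by blast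
        then have "u \<in> cball p' (r n)" using nest(2)[OF p'(1)] ball_subset_cball by blast
        then show ?thesis using cball_disjoint[OF p(1) p'(1) u(2)] p'(2) by simp
      qed
      have near0: "u \<in> cball p (r (Suc n))" if u: "u \<in> B0 n" "u \<in> cball p (r n)" for u
      proof -
        obtain p' where p': "p' \<in> P n" "u \<in> cball p' (r (Suc n))" using u unfolding B0_def by blast
        then have "u \<in> cball p' (r n)" using nest(1)[OF p'(1)] ball_subset_cball by blast
        then show ?thesis using cball_disjoint[OF p(1) p'(1) u(2)] p'(2) by simp
      qed
      have "p \<in> P (Suc n)" "q n p \<in> P (Suc n)" using p(1) by (auto simp: P_Suc)
      then show ?case using near0 near1 in_D xy eq[of n] p by (metis UnE)
    qed
    show "x = y"
    proof (rule ccontr)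
      assume "x \<noteq> y"
      then obtain n where n: "(1/2) ^ n < dist x y" using half_power_less[of "dist x y"] by auto
      obtain p where "x \<in> cball p (r n)" "y \<in> cball p (r n)" using common by blast
      then have "dist x y \<le> 2 * r n" using dist_triangle3[of x y p] by simp
      also have "\<dots> \<le> (1/2) ^ (n * n)" using r_small[of n] r_pos[of n] by simp
      also have "\<dots> \<le> (1/2) ^ n" by (intro power_decreasing) auto
      finally show False using n by simp
    qed
  next
    fix s :: "nat \<Rightarrow> bool"
    \<comment> \<open>The branch prescribed by \<open>s\<close>, moving to the new puncture exactly
      when \<open>s n\<close> holds; the nested compact discs along it contain the required
      point.\<close>
    define t where "t = rec_nat (1, 0) (\<lambda>n p. if s n then q n p else p)"
    have t: "t 0 = (1, 0)" "t (Suc n) = (if s n then q n (t n) else t n)" for n by (auto simp: t_def)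
    have tP: "t n \<in> P n" for n by (induction n) (auto simp: t P_0 P_Suc)
    define E where "E n = riemann_sphere \<inter> cball (t n) (r n)" for n
    have "\<Inter> (range E) \<noteq> {}"
    proof (rule compact_nest)
      show "compact (E n)" for n unfolding E_def by (intro compact_Int compact_sphere compact_cball)
      show "E n \<noteq> {}" for n using tP[of n] P_sphere[of n] r_pos[of n] by (force simp: E_def)
      have "E (Suc n) \<subseteq> E n" for n
        using nest[OF tP[of n]] ball_subset_cball unfolding E_def t by (auto split: if_splits)
      then show "m \<le> n \<Longrightarrow> E n \<subseteq> E m" for m n by (rule lift_Suc_antimono_le[of E])
    qed
    then obtain x where x: "x \<in> E n" for n by blast
    have "x \<in> C" using x tP unfolding C_def D_def E_def by blast
    moreover have "(x \<in> B1 n) = s n" for n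
    proof (cases "s n")
      case True
      then show ?thesis using x[of "Suc n"] tP[of n] by (auto simp: E_def t B1_def)
    next
      case False
      then have "x \<in> B0 n" using x[of "Suc n"] tP[of n] by (auto simp: E_def t B0_def)
      then show ?thesis using disj False by blast
    qed
    ultimately show "\<exists>x\<in>C. \<forall>n. (x \<in> B1 n) = s n" by blast
  qed
  then show ?thesis by (auto simp: is_cantor_set_def C_def)
qed

end

section \<open>Existence of the sequence by dependent choice\<close>

lemma shear_sequence_exists: "\<exists>G P r q. shear_sequence G P r q"
proof -
  \<comment> \<open>The map \<open>q\<close> belongs to a transition rather than to a state, so
    \<open>rel\<close> quantifies it and it is extracted at the end. The clause for
    \<open>n = 0\<close> remembers the first puncture, as the choice rule does not name the initial
    state.\<close>
  define inv where "inv n s = (case s of (G, P, r) \<Rightarrow>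
      punctured_embedding n G P \<and> good_radius n G P r \<and> (n = 0 \<longrightarrow> P = {(1, 0)}))"
    for n and s :: "(rs_point \<Rightarrow> complex \<times> complex) \<times> rs_point set \<times> real"
  define rel where "rel n s s' = (case (s, s') of ((G, P, r), (G', P', r')) \<Rightarrow>
      \<exists>q. shear_step n G P r q G' \<and> P' = P \<union> q ` P \<and>
        (\<forall>p\<in>P. cball p r' \<subseteq> ball p r \<and> cball (q p) r' \<subseteq> ball p r))"
    for n and s s' :: "(rs_point \<Rightarrow> complex \<times> complex) \<times> rs_point set \<times> real"
  have "\<exists>f. \<forall>n. inv n (f n) \<and> rel n (f n) (f (Suc n))"
  proof (rule dependent_nat_choice)
    obtain r where "good_radius 0 (\<lambda>x. (stereo x, 0)) {(1, 0)} r"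
      using eventually_happens'[OF _ eventually_good_radius[OF stereo_punctured_embedding]]
        trivial_limit_at_right_real by blast
    then show "\<exists>s. inv 0 s" using stereo_punctured_embedding unfolding inv_def by auto
  next
    fix s n assume "inv n s"
    then obtain G P r where s: "s = (G, P, r)" and emb: "punctured_embedding n G P" and rad: "good_radius n G P r"
      unfolding inv_def by (cases s) auto
    obtain q G' where step: "shear_step n G P r q G'" and emb': "punctured_embedding (Suc n) G' (P \<union> q ` P)"
      using shear_step_exists[OF emb rad] .
    have fin: "finite P" and r: "0 < r" using emb rad unfolding punctured_embedding_def good_radius_def by auto
    \<comment> \<open>The point \<open>q p\<close> lies in the open disc, so there is room
      \<open>r - dist p (q p) > 0\<close> for the next radius, which is chosen only now.\<close>
    have nest: "\<forall>\<^sub>F r' in at_right 0. \<forall>p\<in>P. cball p r' \<subseteq> ball p r \<and> cball (q p) r' \<subseteq> ball p r"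
    proof (intro eventually_ball_finite fin ballI)
      fix p assume "p \<in> P"
      then have d: "dist p (q p) < r" using step unfolding shear_step_def by auto
      then have "\<forall>\<^sub>F r' in at_right 0. r' < r - dist p (q p)" by (intro eventually_at_right_0_less) simp
      then show "\<forall>\<^sub>F r' in at_right 0. cball p r' \<subseteq> ball p r \<and> cball (q p) r' \<subseteq> ball p r"
      proof eventually_elim
        case (elim r')
        have "r' < r" using elim zero_le_dist[of p "q p"] by linarith
        then have "cball p r' \<subseteq> ball p r" by (simp add: cball_subset_ball_iff)
        moreover have "cball (q p) r' \<subseteq> ball p r"
        proof
          fix x assume "x \<in> cball (q p) r'"
          then show "x \<in> ball p r" using elim dist_triangle[of p x "q p"] by simp
        qed
        ultimately show ?case by blast
      qed
    qed
    obtain r' where r': "good_radius (Suc n) G' (P \<union> q ` P) r'"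
      "\<forall>p\<in>P. cball p r' \<subseteq> ball p r \<and> cball (q p) r' \<subseteq> ball p r"
      using eventually_happens'[OF _ eventually_conj[OF eventually_good_radius[OF emb'] nest]]
        trivial_limit_at_right_real by blast
    have "inv (Suc n) (G', P \<union> q ` P, r')" using emb' r'(1) by (simp add: inv_def)
    moreover have "rel n s (G', P \<union> q ` P, r')"
      unfolding rel_def s using step r'(2) by auto
    ultimately show "\<exists>s'. inv (Suc n) s' \<and> rel n s s'" by blast
  qed
  then obtain f where f: "\<And>n. inv n (f n)" "\<And>n. rel n (f n) (f (Suc n))" by blast
  define G where "G n = fst (f n)" for n
  define P where "P n = fst (snd (f n))" for n
  define r where "r n = snd (snd (f n))" for n
  have eq: "f n = (G n, P n, r n)" for n by (simp add: G_def P_def r_def)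
  have "\<exists>q. shear_step n (G n) (P n) (r n) q (G (Suc n)) \<and> P (Suc n) = P n \<union> q ` P n \<and>
        (\<forall>p\<in>P n. cball p (r (Suc n)) \<subseteq> ball p (r n) \<and> cball (q p) (r (Suc n)) \<subseteq> ball p (r n))" for n
    using f(2)[of n] unfolding eq rel_def by simp
  then obtain q where "\<And>n. shear_step n (G n) (P n) (r n) (q n) (G (Suc n))"
    "\<And>n. P (Suc n) = P n \<union> q n ` P n"
    "\<And>n. \<forall>p\<in>P n. cball p (r (Suc n)) \<subseteq> ball p (r n) \<and> cball (q n p) (r (Suc n)) \<subseteq> ball p (r n)"
    by metis
  moreover have "punctured_embedding n (G n) (P n)" "good_radius n (G n) (P n) (r n)" "P 0 = {(1, 0)}" for n
    using f(1)[of n] f(1)[of 0] unfolding eq inv_def by auto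
  ultimately have "shear_sequence G P r q" by unfold_locales blast+
  then show ?thesis by blast
qed

theorem theorem1p1:
  shows "\<exists>(C :: rs_point set) (g :: rs_point \<Rightarrow> complex \<times> complex).
           is_cantor_set C \<and> sph_hausdorff_dim C = 0 \<and>
           holomorphic_embedding g (riemann_sphere - C) \<and>
           proper_map_on g (riemann_sphere - C)"
proof -
  obtain G P r q where "shear_sequence G P r q" using shear_sequence_exists by blast
  then interpret shear_sequence G P r q .
  show ?thesis using C_cantor C_dimension F_embedding F_proper by blast
qed

end
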